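(* Let $\mathbb{F}=\mathbb{F}(n)$ be any field (finite or infinite, possibly depending on $n$) and let $p=p(n)$ satisfy $n^{-1}\le p\le 1$. Then with probability tending to $1$ as $n\to\infty$, $$\operatorname{minrank}_{\mathbb{F}}(G(n,p))\ \ge\ \frac{n\log(1/p)}{80\log n}.$$
   Context: For a graph $G$ on vertex set $[n]=\{1,\dots,n\}$ and a field $\mathbb{F}$, $\operatorname{minrank}_{\mathbb{F}}(G)$ is the minimum rank of a matrix $M\in\mathbb{F}^{n\times n}$ with all diagonal entries nonzero such that $M_{i,j}=0$ whenever $i\neq j$ and $i,j$ are nonadjacent in $G$. $G(n,p)$ denotes the binomial random graph on $[n]$ in which each pair is an edge independently with probability $p$. The logarithms are taken in the same base (the ratio $\log(1/p)/\log n$ does not depend on the base). *)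

theory Defs
  imports "HOL-Algebra.Ring" "HOL-Probability.Probability"
begin

text \<open>Vertices of a graph on n vertices are 0,...,n-1. A graph is given by an
adjacency predicate. Matrices are functions nat => nat => 'a, considered on
indices below n, with entries in the carrier of an (HOL-Algebra) field R.\<close>

definition matrix_over :: "('a, 'b) ring_scheme \<Rightarrow> nat \<Rightarrow> (nat \<Rightarrow> nat \<Rightarrow> 'a) \<Rightarrow> bool" where
  "matrix_over R n M \<longleftrightarrow> (\<forall>i<n. \<forall>j<n. M i j \<in> carrier R)"

definition cols_indep :: "('a, 'b) ring_scheme \<Rightarrow> nat \<Rightarrow> (nat \<Rightarrow> nat \<Rightarrow> 'a) \<Rightarrow> nat set \<Rightarrow> bool" where
  "cols_indep R n M S \<longleftrightarrow>
     (\<forall>c. (\<forall>j\<in>S. c j \<in> carrier R) \<longrightarrow>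
          (\<forall>i<n. (\<Oplus>\<^bsub>R\<^esub> j\<in>S. c j \<otimes>\<^bsub>R\<^esub> M i j) = \<zero>\<^bsub>R\<^esub>) \<longrightarrow>
          (\<forall>j\<in>S. c j = \<zero>\<^bsub>R\<^esub>))"

definition mat_rank :: "('a, 'b) ring_scheme \<Rightarrow> nat \<Rightarrow> (nat \<Rightarrow> nat \<Rightarrow> 'a) \<Rightarrow> nat" where
  "mat_rank R n M = Max {card S | S. S \<subseteq> {..<n} \<and> cols_indep R n M S}"

definition represents :: "('a, 'b) ring_scheme \<Rightarrow> nat \<Rightarrow> (nat \<Rightarrow> nat \<Rightarrow> bool) \<Rightarrow> (nat \<Rightarrow> nat \<Rightarrow> 'a) \<Rightarrow> bool" where
  "represents R n adj M \<longleftrightarrow> matrix_over R n M \<and>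
     (\<forall>i<n. M i i \<noteq> \<zero>\<^bsub>R\<^esub>) \<and>
     (\<forall>i<n. \<forall>j<n. i \<noteq> j \<and> \<not> adj i j \<longrightarrow> M i j = \<zero>\<^bsub>R\<^esub>)"

definition minrank :: "('a, 'b) ring_scheme \<Rightarrow> nat \<Rightarrow> (nat \<Rightarrow> nat \<Rightarrow> bool) \<Rightarrow> nat" where
  "minrank R n adj = Min {mat_rank R n M | M. represents R n adj M}"

text \<open>Binomial random graph G(n,p): every unordered pair {i,j}, i<j<n, encoded as the
ordered pair (i,j), is an edge independently with probability p.\<close>
definition vertex_pairs :: "nat \<Rightarrow> (nat \<times> nat) set" where
  "vertex_pairs n = {(i, j). i < j \<and> j < n}"

definition gnp :: "nat \<Rightarrow> real \<Rightarrow> (nat \<times> nat \<Rightarrow> bool) pmf" where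
  "gnp n p = Pi_pmf (vertex_pairs n) False (\<lambda>_. bernoulli_pmf p)"

definition adj_of :: "(nat \<times> nat \<Rightarrow> bool) \<Rightarrow> nat \<Rightarrow> nat \<Rightarrow> bool" where
  "adj_of f i j \<longleftrightarrow> i \<noteq> j \<and> f (min i j, max i j)"

end

theory Submission
  imports Defs "HOL-Combinatorics.Permutations" "HOL-Real_Asymp.Real_Asymp"
begin

text \<open>
  Let \<open>M\<close> represent the graph with rank \<open>r\<close>, and let \<open>T\<close> index a principal submatrix that minimises
  the ratio \<open>k / t\<close> of its rank \<open>k\<close> to its size \<open>t\<close>. By minimality, greedy bases of its rows and of its
  columns have at most \<open>s k / t\<close> nonzero entries each, where \<open>s\<close> is the number of nonzero entries of the
  submatrix; let \<open>V\<close> be the union of their supports. Every column of the submatrix meets \<open>V\<close> because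
  its diagonal is nonzero, so \<open>t \<le> \<bar>V\<bar> \<le> 2 s k / t\<close>.

  By Cramer's rule each entry of the submatrix is, up to a common nonzero factor, a polynomial of degree
  at most \<open>k + 1\<close> in the entries on \<open>V\<close>. Hence, by the argument of Ronyai, Babai and Ganapathy, given \<open>V\<close>
  and the index sets of the bases there are at most \<open>(t\<^sup>2 (k + 1) + 1)\<^bsup>\<bar>V\<bar>\<^esup>\<close> zero patterns of the submatrix.
  The graph contains all edges of a fixed pattern with probability at most \<open>p\<^bsup>(s - t) / 2\<^esup>\<close>. If
  \<open>k / t \<le> r / n < ln (1 / p) / (80 ln n)\<close>, this is at most \<open>n\<^bsup>- 19 \<bar>V\<bar>\<^esup>\<close>, which beats
  the number of choices of \<open>V\<close>, of the bases and of the pattern.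
\<close>

text \<open>Layer-cake formula. It lets \<open>light_basis\<close> compare two total weights one
  threshold at a time.\<close>

lemma sum_eq_sum_card_greater:
  fixes w :: "'j \<Rightarrow> nat"
  assumes "finite A" "\<And>j. j \<in> A \<Longrightarrow> w j \<le> n"
  shows "(\<Sum>j\<in>A. w j) = (\<Sum>t<n. card {j\<in>A. t < w j})"
proof -
  have "(\<Sum>j\<in>A. w j) = (\<Sum>j\<in>A. \<Sum>t<n. if t < w j then 1 else 0)"
  proof (intro sum.cong refl)
    fix j assume "j \<in> A"
    then have "{..<n} \<inter> {t. t < w j} = {..<w j}" using assms(2) by fastforce
    then show "w j = (\<Sum>t<n. if t < w j then 1 else 0)" by (simp add: sum.If_cases)
  qed
  also have "\<dots> = (\<Sum>t<n. \<Sum>j\<in>A. if t < w j then 1 else 0)" by (rule sum.swap)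
  also have "\<dots> = (\<Sum>t<n. card {j\<in>A. t < w j})"
    using assms(1) by (simp add: sum.If_cases Int_def)
  finally show ?thesis .
qed

context field
begin

subsection \<open>Linear independence\<close>

lemma nonzero_inverse:
  assumes "x \<in> carrier R" "x \<noteq> \<zero>"
  obtains y where "y \<in> carrier R" "y \<otimes> x = \<one>"
  using assms field_Units Units_inv_closed Units_l_inv by blast

lemma finsum_swap:
  assumes "finite A" "finite B" "\<And>a b. f a b \<in> carrier R"
  shows "(\<Oplus>a\<in>A. \<Oplus>b\<in>B. f a b) = (\<Oplus>b\<in>B. \<Oplus>a\<in>A. f a b)"
  using assms(1)
proof (induct A)
  case empty
  show ?case by (simp add: finsum_zero)
next
  case (insert x F)
  then show ?case
    using assms(2,3) by (simp add: Pi_def finsum_addf)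
qed

lemma finsum_kronecker:
  assumes "finite A" "k \<in> A" "\<And>a. f a \<in> carrier R" "\<And>a. a \<in> A \<Longrightarrow> a \<noteq> k \<Longrightarrow> f a = \<zero>"
  shows "(\<Oplus>a\<in>A. f a) = f k"
proof -
  have "(\<Oplus>a\<in>A. f a) = f k \<oplus> (\<Oplus>a\<in>A - {k}. f a)"
    using assms finsum_insert[of "A - {k}" k f] by (simp add: insert_absorb Pi_def)
  also have "(\<Oplus>a\<in>A - {k}. f a) = \<zero>"
    using assms by (intro add.finprod_one_eqI) auto
  finally show ?thesis using assms by simp
qed

text \<open>Associativity of the product of a row vector, a matrix and a column vector. It serves to
  substitute one family of linear combinations into another.\<close>

lemma finsum_rotate:
  assumes "finite A" "finite B" "\<And>a. c a \<in> carrier R" "\<And>a b. d a b \<in> carrier R"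
    "\<And>b. x b \<in> carrier R"
  shows "(\<Oplus>a\<in>A. c a \<otimes> (\<Oplus>b\<in>B. d a b \<otimes> x b)) = (\<Oplus>b\<in>B. (\<Oplus>a\<in>A. c a \<otimes> d a b) \<otimes> x b)"
proof -
  have "(\<Oplus>a\<in>A. c a \<otimes> (\<Oplus>b\<in>B. d a b \<otimes> x b)) = (\<Oplus>a\<in>A. \<Oplus>b\<in>B. c a \<otimes> (d a b \<otimes> x b))"
    using assms by (simp add: finsum_rdistr Pi_def)
  also have "\<dots> = (\<Oplus>b\<in>B. \<Oplus>a\<in>A. c a \<otimes> (d a b \<otimes> x b))"
    using assms by (intro finsum_swap) auto
  also have "\<dots> = (\<Oplus>b\<in>B. \<Oplus>a\<in>A. c a \<otimes> d a b \<otimes> x b)"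
    using assms by (simp add: m_assoc)
  also have "\<dots> = (\<Oplus>b\<in>B. (\<Oplus>a\<in>A. c a \<otimes> d a b) \<otimes> x b)"
    using assms by (simp add: finsum_ldistr Pi_def)
  finally show ?thesis .
qed

text \<open>The carrier condition is global so that closure needs no index bounds. Arbitrary index
  types matter: later matrices are indexed by exponent functions, by patterns and by option
  values.\<close>

definition entries :: "('i \<Rightarrow> 'j \<Rightarrow> 'a) \<Rightarrow> bool" where
  "entries M \<longleftrightarrow> (\<forall>i j. M i j \<in> carrier R)"

lemma entriesD [simp]: "entries M \<Longrightarrow> M i j \<in> carrier R"
  by (simp add: entries_def)

text \<open>Gaussian elimination by induction on the equations: an equation with a nonzero
  coefficient removes one unknown, so the surplus of unknowns persists.\<close>

lemma homogeneous_system_nontrivial: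
  assumes "finite I" "finite S" "card I < card S" "entries M"
  shows "\<exists>c. (\<forall>j. c j \<in> carrier R) \<and> (\<forall>i\<in>I. (\<Oplus>j\<in>S. c j \<otimes> M i j) = \<zero>) \<and> (\<exists>j\<in>S. c j \<noteq> \<zero>)"
  using assms
proof (induct I arbitrary: S M)
  case empty
  then have "S \<noteq> {}" by auto
  then show ?case by (intro exI[of _ "\<lambda>_. \<one>"]) auto
next
  case (insert i0 I)
  have less: "card I < card S"
    "\<And>S' j0. S = insert j0 S' \<Longrightarrow> finite S' \<Longrightarrow> j0 \<notin> S' \<Longrightarrow> card I < card S'"
    using insert.hyps(1,2) insert.prems(1,2) by simp_all
  show ?case
  proof (cases "\<forall>j\<in>S. M i0 j = \<zero>")
    case True
    obtain c where c: "\<And>j. c j \<in> carrier R" "\<And>i. i \<in> I \<Longrightarrow> (\<Oplus>j\<in>S. c j \<otimes> M i j) = \<zero>"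
      "\<exists>j\<in>S. c j \<noteq> \<zero>"
      using insert.hyps(3)[OF insert.prems(1) less(1) insert.prems(3)] by blast
    have "(\<Oplus>j\<in>S. c j \<otimes> M i0 j) = \<zero>"
      using True c(1) by (intro add.finprod_one_eqI) auto
    then show ?thesis using c by auto
  next
    case False
    then obtain j0 where j0: "j0 \<in> S" "M i0 j0 \<noteq> \<zero>" by auto
    obtain q where q: "q \<in> carrier R" "q \<otimes> M i0 j0 = \<one>"
      using nonzero_inverse[OF entriesD[OF insert.prems(3)] j0(2)] .
    define S' where "S' = S - {j0}"
    have S: "S = insert j0 S'" "finite S'" "j0 \<notin> S'"
      using j0 insert.prems by (auto simp: S'_def)
    \<comment> \<open>Elimination with pivot \<open>M i0 j0\<close>: subtract the multiple of row
      \<open>i0\<close> that clears column \<open>j0\<close>.\<close>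
    define M' where "M' i j = M i j \<ominus> M i j0 \<otimes> (q \<otimes> M i0 j)" for i j
    have entM': "entries M'"
      using insert.prems(3) q by (simp add: M'_def entries_def)
    note M' = entriesD[OF this]
    obtain c where c: "\<And>j. c j \<in> carrier R" "\<And>i. i \<in> I \<Longrightarrow> (\<Oplus>j\<in>S'. c j \<otimes> M' i j) = \<zero>"
      "\<exists>j\<in>S'. c j \<noteq> \<zero>"
      using insert.hyps(3)[OF S(2) less(2)[OF S] entM'] by blast
    define t where "t = (\<Oplus>j\<in>S'. c j \<otimes> M i0 j)"
    have t: "t \<in> carrier R" using c insert.prems by (simp add: t_def)
    \<comment> \<open>Back substitution: the value at \<open>j0\<close> is the one that equation
      \<open>i0\<close> forces.\<close>
    define d where "d j = (if j = j0 then \<ominus> (q \<otimes> t) else c j)" for j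
    have d: "d j \<in> carrier R" for j using q t c by (simp add: d_def)
    have sumd: "(\<Oplus>j\<in>S. d j \<otimes> M i j) = (\<Oplus>j\<in>S'. c j \<otimes> M i j) \<ominus> q \<otimes> t \<otimes> M i j0" for i
    proof -
      have "(\<Oplus>j\<in>S. d j \<otimes> M i j) = d j0 \<otimes> M i j0 \<oplus> (\<Oplus>j\<in>S'. d j \<otimes> M i j)"
        using S d insert.prems by simp
      also have "(\<Oplus>j\<in>S'. d j \<otimes> M i j) = (\<Oplus>j\<in>S'. c j \<otimes> M i j)"
        using S c insert.prems by (intro finsum_cong') (auto simp: d_def)
      also have "d j0 \<otimes> M i j0 \<oplus> (\<Oplus>j\<in>S'. c j \<otimes> M i j) = (\<Oplus>j\<in>S'. c j \<otimes> M i j) \<ominus> q \<otimes> t \<otimes> M i j0"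
        using q t c insert.prems(3) unfolding d_def
        by (simp add: minus_eq l_minus a_comm)
      finally show ?thesis .
    qed
    have "(\<Oplus>j\<in>S. d j \<otimes> M i j) = \<zero>" if "i \<in> insert i0 I" for i
    proof (cases "i = i0")
      case True
      have "t \<ominus> q \<otimes> t \<otimes> M i0 j0 = t \<ominus> t \<otimes> (q \<otimes> M i0 j0)"
        using q(1) t entriesD[OF insert.prems(3), of i0 j0] by algebra
      also have "\<dots> = \<zero>" using t q(2) by (simp add: minus_eq r_neg)
      finally show ?thesis using True sumd t_def by simp
    next
      case False
      then have i: "i \<in> I" using that by simp
      have "c j \<otimes> M i j = c j \<otimes> M' i j \<oplus> (M i j0 \<otimes> q) \<otimes> (c j \<otimes> M i0 j)" for j
        using c(1)[of j] q(1) entriesD[OF insert.prems(3), of i j] entriesD[OF insert.prems(3), of i j0] entriesD[OF insert.prems(3), of i0 j]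
        unfolding M'_def by algebra
      then have "(\<Oplus>j\<in>S'. c j \<otimes> M i j)
          = (\<Oplus>j\<in>S'. c j \<otimes> M' i j \<oplus> (M i j0 \<otimes> q) \<otimes> (c j \<otimes> M i0 j))" by simp
      also have "\<dots> = (\<Oplus>j\<in>S'. c j \<otimes> M' i j) \<oplus> (M i j0 \<otimes> q) \<otimes> t"
        using S c M' q insert.prems unfolding t_def by (simp add: finsum_addf finsum_rdistr)
      also have "\<dots> = M i j0 \<otimes> q \<otimes> t" using c(2)[OF i] q t insert.prems(3) by simp
      finally show ?thesis
        unfolding sumd using q(1) t entriesD[OF insert.prems(3), of i j0] by algebra
    qed
    moreover have "\<exists>j\<in>S. d j \<noteq> \<zero>" using c(3) S by (auto simp: d_def)
    ultimately show ?thesis using d by (intro exI[of _ d]) simp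
  qed
qed

section \<open>Independent sets, spans and bases\<close>

definition lin_indep :: "'i set \<Rightarrow> ('i \<Rightarrow> 'j \<Rightarrow> 'a) \<Rightarrow> 'j set \<Rightarrow> bool" where
  "lin_indep I M S \<longleftrightarrow> (\<forall>c. (\<forall>j. c j \<in> carrier R) \<longrightarrow>
     (\<forall>i\<in>I. (\<Oplus>j\<in>S. c j \<otimes> M i j) = \<zero>) \<longrightarrow> (\<forall>j\<in>S. c j = \<zero>))"

lemma lin_indepD:
  assumes "lin_indep I M S" "\<forall>j. c j \<in> carrier R" "\<forall>i\<in>I. (\<Oplus>j\<in>S. c j \<otimes> M i j) = \<zero>"
  shows "\<forall>j\<in>S. c j = \<zero>"
  using assms unfolding lin_indep_def by blast

lemma lin_indep_card_le:
  assumes "finite I" "finite S" "entries M" "lin_indep I M S"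
  shows "card S \<le> card I"
  using homogeneous_system_nontrivial[of I S M] assms unfolding lin_indep_def by (meson not_le)

lemma lin_indep_mono_rows: "lin_indep I M S \<Longrightarrow> I \<subseteq> I' \<Longrightarrow> lin_indep I' M S"
  unfolding lin_indep_def by (meson subsetD)

lemma lin_indep_empty [simp]: "lin_indep I M {}"
  by (simp add: lin_indep_def)

definition spans :: "'i set \<Rightarrow> ('i \<Rightarrow> 'j \<Rightarrow> 'a) \<Rightarrow> 'j set \<Rightarrow> 'j set \<Rightarrow> bool" where
  "spans I M S U \<longleftrightarrow> (\<exists>d. (\<forall>u j. d u j \<in> carrier R) \<and>
     (\<forall>u\<in>U. \<forall>i\<in>I. M i u = (\<Oplus>j\<in>S. d u j \<otimes> M i j)))"

text \<open>Maximality, rather than spanning, is the definition because it is what a greedy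
  extension delivers; spanning follows in \<open>basis_of_spans\<close>.\<close>

definition basis_of :: "'i set \<Rightarrow> ('i \<Rightarrow> 'j \<Rightarrow> 'a) \<Rightarrow> 'j set \<Rightarrow> 'j set \<Rightarrow> bool" where
  "basis_of I M U S \<longleftrightarrow> S \<subseteq> U \<and> lin_indep I M S \<and>
     (\<forall>S'. S \<subseteq> S' \<longrightarrow> S' \<subseteq> U \<longrightarrow> lin_indep I M S' \<longrightarrow> S' = S)"

lemma basis_of_finite: "finite U \<Longrightarrow> basis_of I M U S \<Longrightarrow> finite S"
  unfolding basis_of_def using finite_subset by blast

text \<open>In a nontrivial relation on \<open>insert u S\<close> the coefficient of
  \<open>u\<close> is nonzero, since \<open>S\<close> is independent, so one can divide by
  it.\<close>

lemma in_span_if_dependent: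
  assumes "finite S" "entries M" "lin_indep I M S" "\<not> lin_indep I M (insert u S)"
  obtains e where "\<And>j. e j \<in> carrier R" "\<And>i. i \<in> I \<Longrightarrow> M i u = (\<Oplus>j\<in>S. e j \<otimes> M i j)"
proof -
  have uS: "u \<notin> S" using assms by (metis insert_absorb)
  obtain c where c: "\<And>j. c j \<in> carrier R" "\<And>i. i \<in> I \<Longrightarrow> (\<Oplus>j\<in>insert u S. c j \<otimes> M i j) = \<zero>"
    "\<exists>j\<in>insert u S. c j \<noteq> \<zero>"
    using assms(4) unfolding lin_indep_def by blast
  have eq: "c u \<otimes> M i u \<oplus> (\<Oplus>j\<in>S. c j \<otimes> M i j) = \<zero>" if "i \<in> I" for i
    using c(2)[OF that] c(1) assms(1,2) uS by simp
  have "c u \<noteq> \<zero>"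
  proof
    assume "c u = \<zero>"
    then have "\<forall>j\<in>S. c j = \<zero>"
      using eq c(1) assms(2,3) unfolding lin_indep_def by simp
    with c(3) \<open>c u = \<zero>\<close> show False by auto
  qed
  then obtain q where q: "q \<in> carrier R" "q \<otimes> c u = \<one>" using nonzero_inverse c(1) by metis
  have *: "M i u = (\<Oplus>j\<in>S. (\<ominus> q \<otimes> c j) \<otimes> M i j)" if "i \<in> I" for i
  proof -
    define t where "t = (\<Oplus>j\<in>S. c j \<otimes> M i j)"
    have t: "t \<in> carrier R" using c(1) assms(2) by (simp add: t_def)
    have "(\<Oplus>j\<in>S. (\<ominus> q \<otimes> c j) \<otimes> M i j) = \<ominus> q \<otimes> t"
      using q c(1) assms(1,2) unfolding t_def by (simp add: finsum_rdistr m_assoc)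
    moreover have "(q \<otimes> c u) \<otimes> M i u = q \<otimes> (c u \<otimes> M i u \<oplus> t) \<oplus> \<ominus> q \<otimes> t"
      using q(1) c(1)[of u] t entriesD[OF assms(2), of i u] by algebra
    ultimately show ?thesis using eq[OF that] q t assms(2) unfolding t_def by simp
  qed
  show thesis
    by (rule that[OF _ *]) (use q c(1) in auto)
qed

lemma basis_of_spans:
  assumes "finite U" "entries M" "basis_of I M U S"
  shows "spans I M S U"
proof -
  have S: "S \<subseteq> U" "lin_indep I M S" "finite S"
    using assms finite_subset unfolding basis_of_def by auto
  have "\<exists>e. (\<forall>j. e j \<in> carrier R) \<and> (\<forall>i\<in>I. M i u = (\<Oplus>j\<in>S. e j \<otimes> M i j))" if u: "u \<in> U" for u
  proof (cases "u \<in> S")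
    case True
    have "M i u = (\<Oplus>j\<in>S. (if j = u then \<one> else \<zero>) \<otimes> M i j)" for i
      using finsum_kronecker[of S u "\<lambda>j. (if j = u then \<one> else \<zero>) \<otimes> M i j"] S True assms(2) by auto
    then show ?thesis by (intro exI[of _ "\<lambda>j. if j = u then \<one> else \<zero>"]) auto
  next
    case False
    then have "\<not> lin_indep I M (insert u S)"
      using assms(3) u unfolding basis_of_def by blast
    then show ?thesis using in_span_if_dependent[of S M I u] S assms(2) by metis
  qed
  then obtain e where "\<And>u. u \<in> U \<Longrightarrow> (\<forall>j. e u j \<in> carrier R) \<and> (\<forall>i\<in>I. M i u = (\<Oplus>j\<in>S. e u j \<otimes> M i j))"
    by metis
  \<comment> \<open>\<open>spans\<close> asks for coefficients at all indices, so those for columns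
    outside \<open>U\<close> are set to zero.\<close>
  then show ?thesis unfolding spans_def
    by (intro exI[of _ "\<lambda>u. if u \<in> U then e u else (\<lambda>_. \<zero>)"]) auto
qed

text \<open>Steinitz: the coefficient vectors of independent columns with respect to
  \<open>S\<close> are themselves independent, and they have only \<open>card S\<close>
  coordinates.\<close>

lemma lin_indep_card_le_spanning:
  assumes "finite S" "finite S'" "entries M"
    and sp: "spans I M S U" and "S' \<subseteq> U" "lin_indep I M S'"
  shows "card S' \<le> card S"
proof -
  obtain d where d: "\<And>u j. d u j \<in> carrier R"
    "\<And>u i. u \<in> U \<Longrightarrow> i \<in> I \<Longrightarrow> M i u = (\<Oplus>j\<in>S. d u j \<otimes> M i j)"
    using sp unfolding spans_def by blast
  have "lin_indep S (\<lambda>j u. d u j) S'"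
    unfolding lin_indep_def
  proof (intro allI impI)
    fix c assume c: "\<forall>j. c j \<in> carrier R" "\<forall>j\<in>S. (\<Oplus>u\<in>S'. c u \<otimes> d u j) = \<zero>"
    have "(\<Oplus>u\<in>S'. c u \<otimes> M i u) = \<zero>" if "i \<in> I" for i
    proof -
      have "(\<Oplus>u\<in>S'. c u \<otimes> M i u) = (\<Oplus>u\<in>S'. c u \<otimes> (\<Oplus>j\<in>S. d u j \<otimes> M i j))"
        using c d(1) assms(3) by (intro finsum_cong') (auto simp: d(2)[OF subsetD[OF assms(5)] that])
      also have "\<dots> = (\<Oplus>j\<in>S. (\<Oplus>u\<in>S'. c u \<otimes> d u j) \<otimes> M i j)"
        using assms(1-3) c(1) d(1) by (intro finsum_rotate) auto
      also have "\<dots> = \<zero>"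
        using c assms(3) by (intro add.finprod_one_eqI) auto
      finally show ?thesis .
    qed
    then show "\<forall>u\<in>S'. c u = \<zero>"
      using assms(6) c(1) unfolding lin_indep_def by blast
  qed
  then show ?thesis using lin_indep_card_le[of S S' "\<lambda>j u. d u j"] assms(1,2) d(1) by (simp add: entries_def)
qed

lemma basis_of_card_ge:
  assumes "finite U" "entries M" "basis_of I M U S" "S' \<subseteq> U" "lin_indep I M S'"
  shows "card S' \<le> card S"
  by (rule lin_indep_card_le_spanning[OF basis_of_finite[OF assms(1,3)] finite_subset[OF assms(4,1)]
        assms(2) basis_of_spans[OF assms(1-3)] assms(4,5)])

lemma lin_indep_extend:
  assumes "finite U" "S \<subseteq> U" "lin_indep I M S"
  obtains S' where "S \<subseteq> S'" "basis_of I M U S'"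
proof -
  let ?F = "{S'. S \<subseteq> S' \<and> S' \<subseteq> U \<and> lin_indep I M S'}"
  have "finite ?F" using assms(1) by (auto intro: finite_subset[of _ "Pow U"])
  then obtain S' where "S' \<in> ?F" "\<forall>S''\<in>?F. S' \<subseteq> S'' \<longrightarrow> S' = S''"
    using finite_has_maximal2[of ?F S] assms(2,3) by auto
  then show thesis by (intro that[of S']) (auto simp: basis_of_def)
qed

section \<open>Row rank and column rank\<close>

definition mtrans :: "('i \<Rightarrow> 'j \<Rightarrow> 'a) \<Rightarrow> 'j \<Rightarrow> 'i \<Rightarrow> 'a" where
  "mtrans M j i = M i j"

lemma entries_mtrans [simp]: "entries M \<Longrightarrow> entries (mtrans M)"
  by (simp add: entries_def mtrans_def)

text \<open>The rows in \<open>U\<close> are combinations of those in \<open>B\<close>, so a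
  relation among columns that holds on \<open>B\<close> holds on \<open>U\<close>.\<close>

lemma lin_indep_rows_basis:
  assumes "finite S" "finite B" "entries M"
    and sp: "spans W (mtrans M) B U" and "S \<subseteq> W" "lin_indep U M S"
  shows "lin_indep B M S"
  unfolding lin_indep_def
proof (intro allI impI)
  fix c assume c: "\<forall>j. c j \<in> carrier R" "\<forall>i\<in>B. (\<Oplus>w\<in>S. c w \<otimes> M i w) = \<zero>"
  obtain d where d: "\<And>u i. d u i \<in> carrier R"
    "\<And>u w. u \<in> U \<Longrightarrow> w \<in> W \<Longrightarrow> M u w = (\<Oplus>i\<in>B. d u i \<otimes> M i w)"
    using sp unfolding spans_def mtrans_def by blast
  have "(\<Oplus>w\<in>S. c w \<otimes> M u w) = \<zero>" if "u \<in> U" for u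
  proof -
    have "(\<Oplus>w\<in>S. c w \<otimes> M u w) = (\<Oplus>w\<in>S. c w \<otimes> (\<Oplus>i\<in>B. M i w \<otimes> d u i))"
      using c d assms(3,5) that by (intro finsum_cong') (auto simp: m_comm)
    also have "\<dots> = (\<Oplus>i\<in>B. (\<Oplus>w\<in>S. c w \<otimes> M i w) \<otimes> d u i)"
      using assms(1-3) c(1) d(1) by (intro finsum_rotate) auto
    also have "\<dots> = \<zero>"
      using c(2) d(1) by (intro add.finprod_one_eqI) auto
    finally show ?thesis .
  qed
  then show "\<forall>j\<in>S. c j = \<zero>"
    using assms(6) c(1) unfolding lin_indep_def by blast
qed

text \<open>Independent columns remain independent on a row basis \<open>B\<close>, where their
  number cannot exceed the number of rows.\<close>

lemma row_rank_le_column_rank: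
  assumes "finite U" "finite W" "entries M"
    and "basis_of W (mtrans M) U B" "S \<subseteq> W" "lin_indep U M S"
  shows "card S \<le> card B"
proof -
  have fin: "finite S" "finite B"
    by (rule finite_subset[OF assms(5,2)]) (rule basis_of_finite[OF assms(1,4)])
  have "spans W (mtrans M) B U"
    by (rule basis_of_spans[OF assms(1) _ assms(4)]) (simp add: assms(3))
  then have "lin_indep B M S"
    by (rule lin_indep_rows_basis[OF fin assms(3) _ assms(5,6)])
  then show ?thesis by (rule lin_indep_card_le[OF fin(2,1) assms(3)])
qed

lemma lin_indep_subset:
  assumes "finite S" "entries M" "lin_indep I M S" "S' \<subseteq> S"
  shows "lin_indep I M S'"
  unfolding lin_indep_def
proof (intro allI impI)
  fix c assume c: "\<forall>j. c j \<in> carrier R" "\<forall>i\<in>I. (\<Oplus>j\<in>S'. c j \<otimes> M i j) = \<zero>"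
  define c' where "c' j = (if j \<in> S' then c j else \<zero>)" for j
  have c': "\<forall>j. c' j \<in> carrier R" using c by (simp add: c'_def)
  have "(\<Oplus>j\<in>S'. c j \<otimes> M i j) = (\<Oplus>j\<in>S. c' j \<otimes> M i j)" for i
    using assms c' by (intro add.finprod_mono_neutral_cong_left) (auto simp: c'_def)
  then have "\<forall>j\<in>S. c' j = \<zero>"
    using assms(3) c c' unfolding lin_indep_def by auto
  then show "\<forall>j\<in>S'. c j = \<zero>" using assms(4) unfolding c'_def by (metis subsetD)
qed

section \<open>Greedy bases\<close>

lemma basis_of_exists:
  assumes "finite U"
  obtains S where "basis_of I M U S"
  using lin_indep_extend[OF assms, of "{}" I M] by auto

lemma basis_of_maximal:
  "basis_of I M U S \<Longrightarrow> S \<subseteq> S' \<Longrightarrow> S' \<subseteq> U \<Longrightarrow> lin_indep I M S' \<Longrightarrow> S' = S"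
  by (simp add: basis_of_def)

lemma basis_of_card_unique:
  assumes "finite U" "entries M" and S: "basis_of I M U S" and S': "basis_of I M U S'"
  shows "card S = card S'"
proof (rule antisym)
  have "S \<subseteq> U" "lin_indep I M S" "S' \<subseteq> U" "lin_indep I M S'"
    using S S' by (auto simp: basis_of_def)
  then show "card S \<le> card S'" "card S' \<le> card S"
    using basis_of_card_ge[OF assms(1,2) S'] basis_of_card_ge[OF assms(1,2) S] by auto
qed

text \<open>Greedy construction: a basis at one threshold is extended to the next. The extension
  adds no lighter columns, because the earlier basis was already maximal among those.\<close>

lemma filtered_basis:
  fixes w :: "'j \<Rightarrow> nat"
  assumes "finite T" "entries M"
  shows "\<exists>S. \<forall>t\<le>n. basis_of I M {j\<in>T. w j \<le> t} {j\<in>S. w j \<le> t}"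
proof (induct n)
  case 0
  obtain S where S: "basis_of I M {j\<in>T. w j \<le> 0} S"
    using basis_of_exists[of "{j\<in>T. w j \<le> 0}" I M] assms by auto
  then have "{j\<in>S. w j \<le> 0} = S" by (auto simp: basis_of_def)
  with S show ?case by (intro exI[of _ S]) auto
next
  case (Suc n)
  then obtain S where S: "\<And>t. t \<le> n \<Longrightarrow> basis_of I M {j\<in>T. w j \<le> t} {j\<in>S. w j \<le> t}"
    by blast
  have "finite {j\<in>T. w j \<le> Suc n}" using assms by simp
  moreover have "{j\<in>S. w j \<le> n} \<subseteq> {j\<in>T. w j \<le> Suc n}" "lin_indep I M {j\<in>S. w j \<le> n}"
    using S[of n] by (auto simp: basis_of_def)
  ultimately obtain S' where S': "{j\<in>S. w j \<le> n} \<subseteq> S'" "basis_of I M {j\<in>T. w j \<le> Suc n} S'"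
    by (rule lin_indep_extend)
  have S'sub: "S' \<subseteq> {j\<in>T. w j \<le> Suc n}" and "lin_indep I M S'"
    using S' by (auto simp: basis_of_def)
  have "basis_of I M {j\<in>T. w j \<le> t} {j\<in>S'. w j \<le> t}" if t: "t \<le> Suc n" for t
  proof (cases "t = Suc n")
    case True
    have "{j\<in>S'. w j \<le> Suc n} = S'" using S'sub by auto
    then show ?thesis using S' True by simp
  next
    case False
    then have b: "basis_of I M {j\<in>T. w j \<le> t} {j\<in>S. w j \<le> t}" using S t by simp
    have "lin_indep I M {j\<in>S'. w j \<le> t}"
      using lin_indep_subset[OF _ assms(2) \<open>lin_indep I M S'\<close>] finite_subset[OF S'sub] assms(1) by auto
    moreover have "{j\<in>S. w j \<le> t} \<subseteq> {j\<in>S'. w j \<le> t}"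
      using S'(1) False t by auto
    moreover have "{j\<in>S'. w j \<le> t} \<subseteq> {j\<in>T. w j \<le> t}"
      using S'sub by auto
    ultimately have "{j\<in>S'. w j \<le> t} = {j\<in>S. w j \<le> t}"
      by (intro basis_of_maximal[OF b])
    with b show ?thesis by simp
  qed
  then show ?case by blast
qed

subsection \<open>Submatrices with sparse bases\<close>

text \<open>The greedy basis, which takes columns by increasing weight, contains a basis of the columns of
  weight at most \<open>t\<close>, for every \<open>t\<close>.\<close>

lemma light_basis:
  fixes w :: "'j \<Rightarrow> nat"
  assumes fin: "finite T" and M: "entries M"
    and dense: "\<And>U S. U \<subseteq> T \<Longrightarrow> basis_of I M U S \<Longrightarrow> k * card U \<le> card S * card T"
    and k: "\<And>S. basis_of I M T S \<Longrightarrow> card S = k"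
  obtains J where "basis_of I M T J" "card T * (\<Sum>j\<in>J. w j) \<le> k * (\<Sum>j\<in>T. w j)"
proof -
  \<comment> \<open>The total serves as a threshold above every single weight.\<close>
  define n where "n = (\<Sum>j\<in>T. w j)"
  have wn: "w j \<le> n" if "j \<in> T" for j unfolding n_def using fin that by (simp add: member_le_sum)
  obtain S where S: "\<And>t. t \<le> n \<Longrightarrow> basis_of I M {j\<in>T. w j \<le> t} {j\<in>S. w j \<le> t}"
    using filtered_basis[OF fin M, of n I w] by blast
  define J where "J = {j\<in>S. w j \<le> n}"
  have "{j\<in>T. w j \<le> n} = T" using wn by auto
  then have J: "basis_of I M T J" using S[of n] J_def by simp
  then have JT: "J \<subseteq> T" by (simp add: basis_of_def)
  have finJ: "finite J" using finite_subset[OF JT fin] .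
  \<comment> \<open>By \<open>dense\<close> the basis has at least its proportional share of the
    light columns, hence at most its share of the heavy ones. Summing over \<open>t\<close> compares
    the total weights.\<close>
  have "card T * card {j\<in>J. t < w j} \<le> k * card {j\<in>T. t < w j}" if "t < n" for t
  proof -
    have split: "card {j\<in>A. t < w j} + card {j\<in>A. w j \<le> t} = card A" if "finite A" for A
      using that by (subst card_Un_disjoint[symmetric]) (auto intro!: arg_cong[where f = card])
    have "{j\<in>S. w j \<le> t} = {j\<in>J. w j \<le> t}" using that by (auto simp: J_def)
    then have d: "k * card {j\<in>T. w j \<le> t} \<le> card {j\<in>J. w j \<le> t} * card T"
      using dense[of "{j\<in>T. w j \<le> t}"] S[of t] that by simp
    have "card T * card {j\<in>J. t < w j} + card {j\<in>J. w j \<le> t} * card T = card T * k"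
      using split[OF finJ] k[OF J] by (simp add: mult.commute[of _ "card T"] flip: distrib_left)
    moreover have "k * card {j\<in>T. t < w j} + k * card {j\<in>T. w j \<le> t} = card T * k"
      using split[OF fin] by (simp add: mult.commute[of _ k] flip: distrib_left)
    ultimately show ?thesis using d by linarith
  qed
  then have "(\<Sum>t<n. card T * card {j\<in>J. t < w j}) \<le> (\<Sum>t<n. k * card {j\<in>T. t < w j})"
    by (intro sum_mono) auto
  moreover have "(\<Sum>j\<in>J. w j) = (\<Sum>t<n. card {j\<in>J. t < w j})"
    "(\<Sum>j\<in>T. w j) = (\<Sum>t<n. card {j\<in>T. t < w j})"
    using finJ fin wn JT by (auto intro!: sum_eq_sum_card_greater)
  ultimately have "card T * (\<Sum>j\<in>J. w j) \<le> k * (\<Sum>j\<in>T. w j)"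
    by (simp only: sum_distrib_left)
  with J show thesis using that by blast
qed

lemma mtrans_mtrans [simp]: "mtrans (mtrans M) = M"
  by (simp add: mtrans_def fun_eq_iff)

text \<open>Follows from \<open>row_rank_le_column_rank\<close> for the matrix and for its
  transpose.\<close>

lemma card_row_basis:
  assumes "finite U" "finite W" "entries M" "basis_of W (mtrans M) U B" "basis_of U M W S"
  shows "card B = card S"
proof (rule antisym)
  have "B \<subseteq> U" "lin_indep W (mtrans M) B" "S \<subseteq> W" "lin_indep U M S"
    using assms(4,5) by (auto simp: basis_of_def)
  then show "card S \<le> card B" "card B \<le> card S"
    using row_rank_le_column_rank[OF assms(1-4)]
      row_rank_le_column_rank[OF assms(2,1) entries_mtrans[OF assms(3)], of S B] assms(5)
    by auto
qed

text \<open>Minimality of the ratio \<open>rank / size\<close> among principal submatrices makes every set of rows and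
  every set of columns of the chosen submatrix as independent as its size predicts.\<close>

lemma sparse_principal_submatrix:
  assumes X: "finite X" "X \<noteq> {}" and M: "entries M" and J0: "basis_of X M X J0"
  obtains T I J where "T \<subseteq> X" "T \<noteq> {}" "basis_of T (mtrans M) T I" "basis_of T M T J"
    "card J * card X \<le> card J0 * card T"
    "card T * (\<Sum>i\<in>I. card {j\<in>T. M i j \<noteq> \<zero>}) \<le> card J * card {(i,j)\<in>T \<times> T. M i j \<noteq> \<zero>}"
    "card T * (\<Sum>j\<in>J. card {i\<in>T. M i j \<noteq> \<zero>}) \<le> card J * card {(i,j)\<in>T \<times> T. M i j \<noteq> \<zero>}"
proof -
  \<comment> \<open>An index set is minimised together with a basis, so that \<open>card J\<close>
    stands for the rank. The pair for \<open>X\<close> itself competes, which later yields the bound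
    on the ratio.\<close>
  let ?F = "{(T, J). T \<subseteq> X \<and> T \<noteq> {} \<and> basis_of T M T J}"
  let ?r = "\<lambda>(T, J). real (card J) / real (card T)"
  have "?F \<subseteq> Pow X \<times> Pow X" by (auto simp: basis_of_def)
  then have "finite ?F" using X by (meson finite_Pow_iff finite_SigmaI finite_subset)
  moreover have "(X, J0) \<in> ?F" using X J0 by simp
  ultimately have "\<exists>q. is_arg_min ?r (\<lambda>x. x \<in> ?F) q"
    by (intro ex_is_arg_min_if_finite) (metis empty_iff)+
  then obtain q where "is_arg_min ?r (\<lambda>x. x \<in> ?F) q" ..
  then have q: "q \<in> ?F" "\<And>y. y \<in> ?F \<Longrightarrow> ?r q \<le> ?r y"
    by (simp_all only: is_arg_min_linorder)
  obtain T J where TJ: "q = (T, J)" by (cases q)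
  have T: "T \<subseteq> X" "T \<noteq> {}" "basis_of T M T J" using q(1) TJ by auto
  have finT: "finite T" using T X finite_subset by blast
  have posT: "card T > 0" using T finT by (simp add: card_gt_0_iff)
  \<comment> \<open>Minimality in cross-multiplied form, which also covers the empty set.\<close>
  have min: "card J * card U \<le> card S * card T" if "U \<subseteq> X" "basis_of U M U S" for U S
  proof (cases "U = {}")
    case False
    then have "card U > 0" using that X finite_subset by (metis card_gt_0_iff)
    moreover have "?r (T, J) \<le> ?r (U, S)" using q(2)[of "(U, S)"] that False unfolding TJ by auto
    ultimately have "real (card J) * real (card U) \<le> real (card S) * real (card T)"
      using posT by (simp add: field_simps)
    then show ?thesis by (metis of_nat_le_iff of_nat_mult)
  qed simp
  \<comment> \<open>Minimality concerns principal submatrices only: it supplies columns in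
    \<open>U\<close> that are independent on the rows \<open>U\<close>. The bounds for the columns
    in \<open>U\<close> on all rows of \<open>T\<close>, and for the rows in \<open>U\<close> on all
    columns of \<open>T\<close>, are derived from these.\<close>
  have indep: "\<exists>S'. S' \<subseteq> U \<and> lin_indep U M S' \<and> card J * card U \<le> card S' * card T" if "U \<subseteq> T" for U
  proof -
    have U: "U \<subseteq> X" "finite U" using that T finT finite_subset by auto
    obtain S' where "basis_of U M U S'" using basis_of_exists[OF U(2)] .
    then show ?thesis using min[OF U(1)] by (auto simp: basis_of_def)
  qed
  have weight: "(\<Sum>j\<in>T. card {i\<in>T. M i j \<noteq> \<zero>}) = card {(i,j)\<in>T \<times> T. M i j \<noteq> \<zero>}"
    "(\<Sum>i\<in>T. card {j\<in>T. M i j \<noteq> \<zero>}) = card {(i,j)\<in>T \<times> T. M i j \<noteq> \<zero>}"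
  proof -
    have "{(i,j)\<in>T \<times> T. M i j \<noteq> \<zero>} = (SIGMA i:T. {j\<in>T. M i j \<noteq> \<zero>})" by auto
    then show "(\<Sum>i\<in>T. card {j\<in>T. M i j \<noteq> \<zero>}) = card {(i,j)\<in>T \<times> T. M i j \<noteq> \<zero>}"
      using finT by (simp add: card_SigmaI)
    have "prod.swap ` {(i,j)\<in>T \<times> T. M i j \<noteq> \<zero>} = (SIGMA j:T. {i\<in>T. M i j \<noteq> \<zero>})" by auto
    then show "(\<Sum>j\<in>T. card {i\<in>T. M i j \<noteq> \<zero>}) = card {(i,j)\<in>T \<times> T. M i j \<noteq> \<zero>}"
      using finT card_image[of prod.swap "{(i,j)\<in>T \<times> T. M i j \<noteq> \<zero>}"] by (simp add: card_SigmaI)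
  qed
  obtain J' where J': "basis_of T M T J'"
    "card T * (\<Sum>j\<in>J'. card {i\<in>T. M i j \<noteq> \<zero>}) \<le> card J * (\<Sum>j\<in>T. card {i\<in>T. M i j \<noteq> \<zero>})"
  proof (rule light_basis[OF finT M])
    fix S assume "basis_of T M T S"
    then show "card S = card J"
      using T(3) by (rule basis_of_card_unique[OF finT M])
  next
    fix U S assume U: "U \<subseteq> T" "basis_of T M U S"
    then obtain S' where S': "S' \<subseteq> U" "lin_indep U M S'" "card J * card U \<le> card S' * card T"
      using indep by blast
    \<comment> \<open>Columns independent on the rows \<open>U\<close> stay independent on the
      larger row set \<open>T\<close>.\<close>
    have "card S' \<le> card S"
      using basis_of_card_ge[OF finite_subset[OF U(1) finT] M U(2) S'(1)] lin_indep_mono_rows S'(2) U(1)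
      by blast
    then show "card J * card U \<le> card S * card T" using S'(3) mult_le_mono1 order_trans by blast
  qed
  obtain I where I: "basis_of T (mtrans M) T I"
    "card T * (\<Sum>i\<in>I. card {j\<in>T. M i j \<noteq> \<zero>}) \<le> card J * (\<Sum>i\<in>T. card {j\<in>T. M i j \<noteq> \<zero>})"
  proof (rule light_basis[OF finT entries_mtrans[OF M]])
    fix S assume "basis_of T (mtrans M) T S"
    then show "card S = card J" using card_row_basis[OF finT finT M] T(3) by blast
  next
    fix U S assume U: "U \<subseteq> T" "basis_of T (mtrans M) U S"
    then obtain S' where S': "S' \<subseteq> U" "lin_indep U M S'" "card J * card U \<le> card S' * card T"
      using indep by blast
    \<comment> \<open>Columns independent on the rows \<open>U\<close> bound the rank of these rows
      from below.\<close>
    have "card S' \<le> card S"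
      using row_rank_le_column_rank[OF finite_subset[OF U(1) finT] finT M U(2) _ S'(2)] S'(1) U(1) by auto
    then show "card J * card U \<le> card S * card T" using S'(3) mult_le_mono1 order_trans by blast
  qed
  have "card J' = card J"
    using card_row_basis[OF finT finT M I(1)] J'(1) T(3) by metis
  then show thesis
    using that[OF T(1,2) I(1) J'(1)] I(2) J'(2) min[OF order_refl J0] weight by auto
qed

text \<open>\<open>V\<close> is covered by the nonzero entries of the basis rows and those of the
  basis columns; each of the two numbers, times \<open>card T\<close>, is at most
  \<open>K\<close>.\<close>

lemma support_of_bases:
  assumes T: "finite T" and M: "entries M" and diag: "\<And>i. i \<in> T \<Longrightarrow> M i i \<noteq> \<zero>"
    and I: "basis_of T (mtrans M) T I" and J: "J \<subseteq> T"
    and wI: "card T * (\<Sum>i\<in>I. card {j\<in>T. M i j \<noteq> \<zero>}) \<le> K"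
    and wJ: "card T * (\<Sum>j\<in>J. card {i\<in>T. M i j \<noteq> \<zero>}) \<le> K"
  defines "V \<equiv> {(i, j)\<in>T \<times> T. M i j \<noteq> \<zero> \<and> (i \<in> I \<or> j \<in> J)}"
  shows "card T * card V \<le> 2 * K" "snd ` V = T"
proof -
  have IT: "I \<subseteq> T" using I by (simp add: basis_of_def)
  have fin: "finite I" "finite J" using IT J T finite_subset by auto
  let ?VI = "SIGMA i:I. {j\<in>T. M i j \<noteq> \<zero>}" and ?VJ = "SIGMA j:J. {i\<in>T. M i j \<noteq> \<zero>}"
  have "V \<subseteq> ?VI \<union> prod.swap ` ?VJ" by (auto simp: V_def image_iff)
  then have "card V \<le> card (?VI \<union> prod.swap ` ?VJ)"
    using fin T by (intro card_mono finite_UnI finite_imageI finite_SigmaI) auto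
  also have "\<dots> \<le> card ?VI + card (prod.swap ` ?VJ)" by (rule card_Un_le)
  also have "\<dots> \<le> card ?VI + card ?VJ"
    using fin T by (intro add_left_mono card_image_le finite_SigmaI) auto
  also have "\<dots> = (\<Sum>i\<in>I. card {j\<in>T. M i j \<noteq> \<zero>}) + (\<Sum>j\<in>J. card {i\<in>T. M i j \<noteq> \<zero>})"
    using fin T by (simp add: card_SigmaI)
  finally have "card T * card V \<le> card T * ((\<Sum>i\<in>I. card {j\<in>T. M i j \<noteq> \<zero>}) + (\<Sum>j\<in>J. card {i\<in>T. M i j \<noteq> \<zero>}))"
    by (rule mult_left_mono) simp
  also have "\<dots> \<le> 2 * K" using wI wJ by (simp add: distrib_left)
  finally show "card T * card V \<le> 2 * K" .
  obtain d where d: "\<And>u j. d u j \<in> carrier R"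
    "\<And>u i. u \<in> T \<Longrightarrow> i \<in> T \<Longrightarrow> mtrans M i u = (\<Oplus>j\<in>I. d u j \<otimes> mtrans M i j)"
    using basis_of_spans[OF T entries_mtrans[OF M] I] unfolding spans_def by blast
  \<comment> \<open>A column that vanishes on the basis rows vanishes on every row they span, row
    \<open>u\<close> included, against the nonzero diagonal entry.\<close>
  have "\<exists>i\<in>I. M i u \<noteq> \<zero>" if "u \<in> T" for u
  proof (rule ccontr)
    assume "\<not> (\<exists>i\<in>I. M i u \<noteq> \<zero>)"
    then have "(\<Oplus>j\<in>I. d u j \<otimes> mtrans M u j) = \<zero>"
      using d(1) by (intro add.finprod_one_eqI) (auto simp: mtrans_def)
    then show False using d(2)[OF that that] diag[OF that] by (simp add: mtrans_def)
  qed
  then show "snd ` V = T"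
    using IT unfolding V_def by (force simp: image_iff)
qed

subsection \<open>Determinants\<close>

text \<open>The sign is taken inside the field, so that it can multiply field elements.\<close>

definition perm_sign :: "('i \<Rightarrow> 'i) \<Rightarrow> 'a" where
  "perm_sign p = (if evenperm p then \<one> else \<ominus> \<one>)"

definition leibniz_det :: "'i set \<Rightarrow> ('i \<Rightarrow> 'i \<Rightarrow> 'a) \<Rightarrow> 'a" where
  "leibniz_det I A = (\<Oplus>p\<in>{p. p permutes I}. perm_sign p \<otimes> (\<Otimes>i\<in>I. A i (p i)))"

lemma perm_sign_closed [simp]: "perm_sign p \<in> carrier R"
  by (simp add: perm_sign_def)

lemma perm_sign_compose:
  assumes "finite I" "p permutes I" "q permutes I"
  shows "perm_sign (p \<circ> q) = perm_sign p \<otimes> perm_sign q"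
proof -
  have "evenperm (p \<circ> q) \<longleftrightarrow> evenperm p = evenperm q"
    using assms evenperm_comp permutation_permutes by blast
  then show ?thesis by (auto simp: perm_sign_def l_minus r_minus)
qed

lemma leibniz_det_closed [simp]: "entries A \<Longrightarrow> leibniz_det I A \<in> carrier R"
  unfolding leibniz_det_def by (intro finsum_closed) (auto intro!: finprod_closed)

lemma leibniz_det_cong:
  assumes "entries B" "\<And>i j. i \<in> I \<Longrightarrow> j \<in> I \<Longrightarrow> A i j = B i j"
  shows "leibniz_det I A = leibniz_det I B"
  unfolding leibniz_det_def
proof (intro finsum_cong' refl)
  fix p assume "p \<in> {p. p permutes I}"
  then have "(\<Otimes>i\<in>I. A i (p i)) = (\<Otimes>i\<in>I. B i (p i))"
    using assms by (intro finprod_cong') (auto simp: permutes_in_image)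
  then show "perm_sign p \<otimes> (\<Otimes>i\<in>I. A i (p i)) = perm_sign p \<otimes> (\<Otimes>i\<in>I. B i (p i))" by simp
qed (use assms(1) in \<open>auto intro!: finprod_closed\<close>)

lemma finprod_row_update:
  assumes "finite I" "k \<in> I" "entries A" "\<And>j. x j \<in> carrier R"
  shows "(\<Otimes>i\<in>I. (A(k := x)) i (p i)) = x (p k) \<otimes> (\<Otimes>i\<in>I - {k}. A i (p i))"
proof -
  have "(\<Otimes>i\<in>I. (A(k := x)) i (p i)) = (\<Otimes>i\<in>insert k (I - {k}). (A(k := x)) i (p i))"
    using assms by (simp add: insert_absorb)
  also have "\<dots> = x (p k) \<otimes> (\<Otimes>i\<in>I - {k}. (A(k := x)) i (p i))"
    using assms by (subst finprod_insert) auto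
  also have "(\<Otimes>i\<in>I - {k}. (A(k := x)) i (p i)) = (\<Otimes>i\<in>I - {k}. A i (p i))"
    using assms by (intro finprod_cong') auto
  finally show ?thesis .
qed

text \<open>Linearity in row \<open>k\<close>: each Leibniz term has exactly one factor from that
  row, and the other factors do not depend on it.\<close>

lemma leibniz_det_row_lincomb:
  assumes I: "finite I" "k \<in> I" and A: "entries A" and L: "finite L"
    and c: "\<And>l. c l \<in> carrier R" and x: "entries x"
  shows "leibniz_det I (A(k := \<lambda>j. \<Oplus>l\<in>L. c l \<otimes> x l j)) = (\<Oplus>l\<in>L. c l \<otimes> leibniz_det I (A(k := x l)))"
proof -
  define P where "P p = (\<Otimes>i\<in>I - {k}. A i (p i))" for p
  have P: "P p \<in> carrier R" for p using A by (simp add: P_def)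
  have fin: "finite {p. p permutes I}" using I by (rule_tac finite_permutations)
  have "leibniz_det I (A(k := \<lambda>j. \<Oplus>l\<in>L. c l \<otimes> x l j))
      = (\<Oplus>p\<in>{p. p permutes I}. perm_sign p \<otimes> ((\<Oplus>l\<in>L. c l \<otimes> x l (p k)) \<otimes> P p))"
    unfolding leibniz_det_def P_def using c x by (subst finprod_row_update[OF I A]) auto
  also have "\<dots> = (\<Oplus>p\<in>{p. p permutes I}. \<Oplus>l\<in>L. c l \<otimes> (perm_sign p \<otimes> (x l (p k) \<otimes> P p)))"
  proof (intro finsum_cong' refl)
    fix p
    have "(\<Oplus>l\<in>L. c l \<otimes> (perm_sign p \<otimes> (x l (p k) \<otimes> P p)))
        = (\<Oplus>l\<in>L. (perm_sign p \<otimes> P p) \<otimes> (c l \<otimes> x l (p k)))"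
      using c entriesD[OF x] P perm_sign_closed[of p] by (intro finsum_cong' refl) (simp_all add: m_ac)
    also have "\<dots> = (perm_sign p \<otimes> P p) \<otimes> (\<Oplus>l\<in>L. c l \<otimes> x l (p k))"
      using c x P L by (subst finsum_rdistr) auto
    also have "\<dots> = perm_sign p \<otimes> ((\<Oplus>l\<in>L. c l \<otimes> x l (p k)) \<otimes> P p)"
      using c x P by (simp add: m_ac)
    finally show "perm_sign p \<otimes> ((\<Oplus>l\<in>L. c l \<otimes> x l (p k)) \<otimes> P p)
        = (\<Oplus>l\<in>L. c l \<otimes> (perm_sign p \<otimes> (x l (p k) \<otimes> P p)))" by simp
  qed (use c x P in auto)
  also have "\<dots> = (\<Oplus>l\<in>L. \<Oplus>p\<in>{p. p permutes I}. c l \<otimes> (perm_sign p \<otimes> (x l (p k) \<otimes> P p)))"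
    using fin L c x P by (intro finsum_swap) auto
  also have "\<dots> = (\<Oplus>l\<in>L. c l \<otimes> (\<Oplus>p\<in>{p. p permutes I}. perm_sign p \<otimes> (x l (p k) \<otimes> P p)))"
    using fin c x P by (subst finsum_rdistr) auto
  also have "\<dots> = (\<Oplus>l\<in>L. c l \<otimes> leibniz_det I (A(k := x l)))"
    unfolding leibniz_det_def P_def using x by (subst finprod_row_update[OF I A]) auto
  finally show ?thesis .
qed

lemma finprod_permute:
  assumes "p permutes I" "\<And>i. f i \<in> carrier R"
  shows "(\<Otimes>i\<in>I. f (p i)) = (\<Otimes>i\<in>I. f i)"
  using finprod_reindex[of f p I] assms permutes_image[OF assms(1)] permutes_inj_on[OF assms(1)]
  by (auto simp: Pi_def)

text \<open>Reindex the permutations by composition with \<open>f\<close>, then each product by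
  \<open>f\<close>; only the sign of \<open>f\<close> remains.\<close>

lemma leibniz_det_permute_rows:
  assumes I: "finite I" and f: "f permutes I" and A: "entries A"
  shows "leibniz_det I (\<lambda>i. A (f i)) = perm_sign f \<otimes> leibniz_det I A"
proof -
  let ?P = "{p. p permutes I}"
  have inj: "inj_on (\<lambda>q. q \<circ> f) ?P"
  proof (rule inj_onI)
    fix q r assume "q \<circ> f = r \<circ> f"
    then show "q = r" using permutes_surj[OF f] by (metis comp_apply ext surjD)
  qed
  have img: "(\<lambda>q. q \<circ> f) ` ?P = ?P"
  proof
    show "?P \<subseteq> (\<lambda>q. q \<circ> f) ` ?P"
    proof
      fix p assume "p \<in> ?P"
      then have "p \<circ> inv_into UNIV f \<in> ?P" "(p \<circ> inv_into UNIV f) \<circ> f = p"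
        using f by (auto simp: permutes_compose permutes_inv comp_assoc permutes_inv_o)
      then show "p \<in> (\<lambda>q. q \<circ> f) ` ?P" by (metis imageI)
    qed
  qed (use f permutes_compose in auto)
  have "leibniz_det I (\<lambda>i. A (f i)) = (\<Oplus>p\<in>(\<lambda>q. q \<circ> f) ` ?P. perm_sign p \<otimes> (\<Otimes>i\<in>I. A (f i) (p i)))"
    unfolding leibniz_det_def img ..
  also have "\<dots> = (\<Oplus>q\<in>?P. perm_sign (q \<circ> f) \<otimes> (\<Otimes>i\<in>I. A (f i) ((q \<circ> f) i)))"
    using A inj by (subst finsum_reindex) (auto intro!: finprod_closed)
  also have "\<dots> = (\<Oplus>q\<in>?P. perm_sign f \<otimes> (perm_sign q \<otimes> (\<Otimes>i\<in>I. A i (q i))))"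
  proof (intro finsum_cong' refl)
    fix q assume "q \<in> ?P"
    then have q: "q permutes I" by simp
    have "(\<Otimes>i\<in>I. A (f i) ((q \<circ> f) i)) = (\<Otimes>i\<in>I. A i (q i))"
      using finprod_permute[OF f, of "\<lambda>i. A i (q i)"] A by simp
    then show "perm_sign (q \<circ> f) \<otimes> (\<Otimes>i\<in>I. A (f i) ((q \<circ> f) i))
        = perm_sign f \<otimes> (perm_sign q \<otimes> (\<Otimes>i\<in>I. A i (q i)))"
      using perm_sign_compose[OF I q f] A by (simp add: m_ac)
  qed (use A in \<open>auto intro!: finprod_closed\<close>)
  also have "\<dots> = perm_sign f \<otimes> leibniz_det I A"
    unfolding leibniz_det_def using A I by (subst finsum_rdistr) (auto intro!: finprod_closed finite_permutations)
  finally show ?thesis .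
qed

text \<open>Pair every even permutation with its composition with the transposition of
  \<open>a\<close> and \<open>b\<close>: the two terms cancel. Unlike an argument from det = -det,
  this also covers characteristic 2.\<close>

lemma leibniz_det_identical_rows:
  assumes I: "finite I" and ab: "a \<in> I" "b \<in> I" "a \<noteq> b" and A: "entries A"
    and eq: "\<And>j. j \<in> I \<Longrightarrow> A a j = A b j"
  shows "leibniz_det I A = \<zero>"
proof -
  let ?t = "Transposition.transpose a b"
  have t: "?t permutes I" using ab by (simp add: permutes_swap_id)
  have tt: "?t \<circ> ?t = id" by (simp add: fun_eq_iff)
  have odd: "\<not> evenperm ?t" using ab(3) by (simp add: evenperm_swap)
  define E where "E = {p. p permutes I \<and> evenperm p}"
  define F where "F p = (\<Otimes>i\<in>I. A i (p i))" for p
  have F: "F p \<in> carrier R" for p using A by (simp add: F_def)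
  have perm_t: "p \<circ> ?t permutes I" if "p permutes I" for p using that t by (simp add: permutes_compose)
  have ev_t: "evenperm (p \<circ> ?t) \<longleftrightarrow> \<not> evenperm p" if "p permutes I" for p
    using that t odd I evenperm_comp permutation_permutes by blast
  have finE: "finite E" using I finite_permutations[OF I] by (auto simp: E_def intro: finite_subset)
  have split: "{p. p permutes I} = E \<union> (\<lambda>p. p \<circ> ?t) ` E"
  proof (intro Set.set_eqI iffI)
    fix p assume p: "p \<in> {p. p permutes I}"
    show "p \<in> E \<union> (\<lambda>p. p \<circ> ?t) ` E"
    proof (cases "evenperm p")
      case False
      then have "p \<circ> ?t \<in> E" using p perm_t ev_t by (simp add: E_def)
      moreover have "p = (p \<circ> ?t) \<circ> ?t" by (simp add: comp_assoc tt)
      ultimately show ?thesis by blast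
    qed (use p E_def in auto)
  qed (auto simp: E_def perm_t)
  have disj: "E \<inter> (\<lambda>p. p \<circ> ?t) ` E = {}"
    using ev_t by (auto simp: E_def)
  have inj: "inj_on (\<lambda>p. p \<circ> ?t) E"
    by (rule inj_onI) (metis comp_assoc tt comp_id)
  have Ft: "F (p \<circ> ?t) = F p" if p: "p permutes I" for p
  proof -
    have "F (p \<circ> ?t) = (\<Otimes>i\<in>I. A (?t i) (p (?t i)))"
      unfolding F_def
    proof (intro finprod_cong' refl)
      fix i assume i: "i \<in> I"
      then have "p (?t i) \<in> I" using p t by (simp add: permutes_in_image)
      then show "A i ((p \<circ> ?t) i) = A (?t i) (p (?t i))"
        using eq by (auto simp: Transposition.transpose_def)
    qed (use A in auto)
    also have "\<dots> = F p" unfolding F_def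
      using finprod_permute[OF t, of "\<lambda>i. A i (p i)"] A by simp
    finally show ?thesis .
  qed
  have "leibniz_det I A = (\<Oplus>p\<in>E \<union> (\<lambda>p. p \<circ> ?t) ` E. perm_sign p \<otimes> F p)"
    unfolding leibniz_det_def split F_def ..
  also have "\<dots> = (\<Oplus>p\<in>E. perm_sign p \<otimes> F p) \<oplus> (\<Oplus>p\<in>(\<lambda>p. p \<circ> ?t) ` E. perm_sign p \<otimes> F p)"
    using finE disj F by (intro finsum_Un_disjoint) auto
  also have "(\<Oplus>p\<in>(\<lambda>p. p \<circ> ?t) ` E. perm_sign p \<otimes> F p) = (\<Oplus>p\<in>E. perm_sign (p \<circ> ?t) \<otimes> F (p \<circ> ?t))"
    using F inj by (intro finsum_reindex) auto
  also have "(\<Oplus>p\<in>E. perm_sign p \<otimes> F p) \<oplus> \<dots>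
      = (\<Oplus>p\<in>E. perm_sign p \<otimes> F p \<oplus> perm_sign (p \<circ> ?t) \<otimes> F (p \<circ> ?t))"
    using F by (subst finsum_addf) auto
  also have "\<dots> = \<zero>"
    using F Ft ev_t by (intro add.finprod_one_eqI) (auto simp: E_def perm_sign_def l_minus r_neg)
  finally show ?thesis .
qed

lemma leibniz_det_one:
  assumes "finite I"
  shows "leibniz_det I (\<lambda>i j. if i = j then \<one> else \<zero>) = \<one>"
proof -
  let ?A = "\<lambda>i j. if i = j then \<one> else \<zero>"
  have zero: "(\<Otimes>i\<in>I. ?A i (p i)) = \<zero>" if p: "p permutes I" and ne: "p \<noteq> id" for p
  proof -
    obtain k where k: "p k \<noteq> k" using ne by (auto simp: fun_eq_iff)
    then have "k \<in> I" using p by (meson permutes_not_in)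
    then have "(\<Otimes>i\<in>I. ?A i (p i)) = ?A k (p k) \<otimes> (\<Otimes>i\<in>I - {k}. ?A i (p i))"
      using finprod_insert[of "I - {k}" k "\<lambda>i. ?A i (p i)"] assms by (simp add: insert_absorb)
    then show ?thesis using k by simp
  qed
  define h where "h p = perm_sign p \<otimes> (\<Otimes>i\<in>I. ?A i (p i))" for p
  have "h p \<in> carrier R" for p by (auto simp: h_def intro!: finprod_closed)
  then have "(\<Oplus>p\<in>{p. p permutes I}. h p) = h id"
    using assms by (intro finsum_kronecker) (auto simp: finite_permutations permutes_id zero h_def)
  also have "h id = \<one>" by (simp add: h_def perm_sign_def)
  finally show ?thesis by (simp add: leibniz_det_def h_def)
qed

text \<open>Takes the place of multiplicativity. Expanding all rows by linearity leaves determinants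
  whose rows are rows of \<open>A\<close>: such a choice of rows either repeats a row or permutes
  them all, and both give zero.\<close>

lemma leibniz_det_rows_in_span:
  assumes I: "finite I" and A: "entries A" and d: "entries d" and det0: "leibniz_det I A = \<zero>"
  shows "leibniz_det I (\<lambda>i j. \<Oplus>l\<in>I. d i l \<otimes> A l j) = \<zero>"
proof -
  define B where "B i j = (\<Oplus>l\<in>I. d i l \<otimes> A l j)" for i j
  have B: "entries B" using A d by (auto simp: entries_def B_def)
  \<comment> \<open>Rows in \<open>X\<close> are still combinations, the others are already rows of
    \<open>A\<close> selected by \<open>f\<close>. The induction on \<open>X\<close> needs every
    \<open>f\<close>, since expanding row \<open>x\<close> changes \<open>f\<close> at
    \<open>x\<close>.\<close>
  have "leibniz_det I (\<lambda>i. if i \<in> X then B i else A (f i)) = \<zero>" if "finite X" "X \<subseteq> I" "f \<in> I \<rightarrow> I" for X f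
    using that
  proof (induct X arbitrary: f)
    case empty
    show ?case
    proof (cases "inj_on f I")
      case True
      \<comment> \<open>\<open>permutes\<close> demands the identity outside
        \<open>I\<close>.\<close>
      define g where "g i = (if i \<in> I then f i else i)" for i
      have "g permutes I"
      proof (rule bij_imp_permutes)
        have "f ` I = I" using True empty I by (intro endo_inj_surj) auto
        then show "bij_betw g I I"
          using True by (auto simp: bij_betw_def g_def inj_on_def)
      qed (simp add: g_def)
      then have "leibniz_det I (\<lambda>i. A (g i)) = \<zero>"
        using leibniz_det_permute_rows[OF I _ A] det0 by simp
      moreover have "leibniz_det I (\<lambda>i. A (f i)) = leibniz_det I (\<lambda>i. A (g i))"
        using A by (intro leibniz_det_cong) (auto simp: g_def entries_def)
      ultimately show ?thesis by simp
    next
      case False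
      then obtain a b where "a \<in> I" "b \<in> I" "a \<noteq> b" "f a = f b" by (auto simp: inj_on_def)
      then have "leibniz_det I (\<lambda>i. A (f i)) = \<zero>"
        using A by (intro leibniz_det_identical_rows[OF I, of a b]) (auto simp: entries_def)
      then show ?thesis by simp
    qed
  next
    case (insert x X)
    let ?C = "\<lambda>i. if i \<in> X then B i else A (f i)"
    have xI: "x \<in> I" using insert.prems by simp
    have C: "entries ?C" using A B by (simp add: entries_def)
    have "(\<lambda>i. if i \<in> insert x X then B i else A (f i)) = ?C(x := \<lambda>j. \<Oplus>l\<in>I. d x l \<otimes> A l j)"
      by (auto simp: fun_eq_iff B_def)
    then have "leibniz_det I (\<lambda>i. if i \<in> insert x X then B i else A (f i))
        = (\<Oplus>l\<in>I. d x l \<otimes> leibniz_det I (?C(x := A l)))"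
      using leibniz_det_row_lincomb[OF I xI C I _ A, of "d x"] d by simp
    also have "\<dots> = \<zero>"
    proof (rule add.finprod_one_eqI)
      fix l assume l: "l \<in> I"
      have "?C(x := A l) = (\<lambda>i. if i \<in> X then B i else A ((f(x := l)) i))"
        using insert.hyps by (auto simp: fun_eq_iff)
      moreover have "leibniz_det I (\<lambda>i. if i \<in> X then B i else A ((f(x := l)) i)) = \<zero>"
        using insert.prems l by (intro insert.hyps(3)) auto
      ultimately show "d x l \<otimes> leibniz_det I (?C(x := A l)) = \<zero>" using d by simp
    qed
    finally show ?case .
  qed
  from this[of I id] I have "leibniz_det I (\<lambda>i. if i \<in> I then B i else A (id i)) = \<zero>" by simp
  moreover have "leibniz_det I B = leibniz_det I (\<lambda>i. if i \<in> I then B i else A (id i))"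
    using A B by (intro leibniz_det_cong) (auto simp: entries_def)
  ultimately have "leibniz_det I B = \<zero>" by simp
  then show ?thesis by (simp add: B_def[abs_def])
qed

text \<open>Independent rows span every unit vector. If the determinant vanished,
  \<open>leibniz_det_rows_in_span\<close> would make the determinant of the identity matrix
  zero.\<close>

lemma leibniz_det_nonzero:
  assumes I: "finite I" and A: "entries A" and indep: "lin_indep I (mtrans A) I"
  shows "leibniz_det I A \<noteq> \<zero>"
proof
  assume det0: "leibniz_det I A = \<zero>"
  have "\<exists>e. (\<forall>l. e l \<in> carrier R) \<and> (\<forall>j\<in>I. (if k = j then \<one> else \<zero>) = (\<Oplus>l\<in>I. e l \<otimes> A l j))" for k
  proof -
    \<comment> \<open>The unit vector \<open>k\<close> is adjoined, under the index
      \<open>None\<close>, to the rows of \<open>A\<close>. These are now \<open>card I + 1\<close>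
      vectors with \<open>card I\<close> coordinates, hence dependent.\<close>
    define M where "M j x = (case x of None \<Rightarrow> if k = j then \<one> else \<zero> | Some l \<Rightarrow> A l j)" for j x
    have M: "entries M" using A by (auto simp: entries_def M_def split: option.split)
    have sumM: "(\<Oplus>x\<in>Some ` I. c x \<otimes> M j x) = (\<Oplus>l\<in>I. c (Some l) \<otimes> A l j)"
      if "\<forall>x. c x \<in> carrier R" for c j
      using that M by (subst finsum_reindex) (auto simp: M_def A)
    have ind: "lin_indep I M (Some ` I)"
      unfolding lin_indep_def
    proof (intro allI impI)
      fix c assume c: "\<forall>x. c x \<in> carrier R" "\<forall>j\<in>I. (\<Oplus>x\<in>Some ` I. c x \<otimes> M j x) = \<zero>"
      then have "\<forall>j\<in>I. (\<Oplus>l\<in>I. c (Some l) \<otimes> mtrans A j l) = \<zero>"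
        by (simp add: sumM mtrans_def)
      then have "\<forall>l\<in>I. c (Some l) = \<zero>"
        by (intro lin_indepD[OF indep, of "\<lambda>l. c (Some l)"] allI c(1)[rule_format])
      then show "\<forall>x\<in>Some ` I. c x = \<zero>" by auto
    qed
    have "\<not> lin_indep I M (insert None (Some ` I))"
    proof
      assume "lin_indep I M (insert None (Some ` I))"
      then have "card (insert None (Some ` I)) \<le> card I"
        using I M by (intro lin_indep_card_le) auto
      then show False using I by (simp add: card_image)
    qed
    then obtain e where e: "\<And>x. e x \<in> carrier R"
      "\<And>j. j \<in> I \<Longrightarrow> M j None = (\<Oplus>x\<in>Some ` I. e x \<otimes> M j x)"
      by (rule in_span_if_dependent[OF finite_imageI[OF I] M ind]) auto
    have "\<forall>j\<in>I. (if k = j then \<one> else \<zero>) = (\<Oplus>l\<in>I. e (Some l) \<otimes> A l j)"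
    proof
      fix j assume "j \<in> I"
      then have "M j None = (\<Oplus>l\<in>I. e (Some l) \<otimes> A l j)" using e sumM by simp
      then show "(if k = j then \<one> else \<zero>) = (\<Oplus>l\<in>I. e (Some l) \<otimes> A l j)" by (simp add: M_def)
    qed
    then show ?thesis using e(1) by (intro exI[of _ "\<lambda>l. e (Some l)"]) simp
  qed
  then obtain d where d: "\<And>k. (\<forall>l. d k l \<in> carrier R) \<and>
      (\<forall>j\<in>I. (if k = j then \<one> else \<zero>) = (\<Oplus>l\<in>I. d k l \<otimes> A l j))"
    by metis
  have "leibniz_det I (\<lambda>i j. \<Oplus>l\<in>I. d i l \<otimes> A l j) = \<zero>"
    using d by (intro leibniz_det_rows_in_span[OF I A _ det0]) (simp add: entries_def)
  moreover have "leibniz_det I (\<lambda>i j. if i = j then \<one> else \<zero>)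
      = leibniz_det I (\<lambda>i j. \<Oplus>l\<in>I. d i l \<otimes> A l j)"
  proof (rule leibniz_det_cong)
    show "entries (\<lambda>i j. \<Oplus>l\<in>I. d i l \<otimes> A l j)"
      using d A by (auto simp: entries_def)
  qed (use d in blast)
  ultimately show False using leibniz_det_one[OF I] by simp
qed

text \<open>Cramer's rule for the coordinates of row \<open>a\<close> in terms of the rows in \<open>I\<close>.\<close>

lemma entry_via_basis_rows:
  assumes I: "finite I" "\<beta> ` I \<subseteq> T" and M: "entries M" and c: "\<And>i. c i \<in> carrier R"
    and row: "\<And>b. b \<in> T \<Longrightarrow> M a b = (\<Oplus>i\<in>I. c i \<otimes> M i b)" and b: "b \<in> T"
  defines "A \<equiv> \<lambda>i j. M i (\<beta> j)"
  shows "(\<Oplus>i\<in>I. leibniz_det I (A(i := \<lambda>j. M a (\<beta> j))) \<otimes> M i b) = leibniz_det I A \<otimes> M a b"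
proof -
  have A: "entries A" using M by (simp add: A_def entries_def)
  have "leibniz_det I (A(i := \<lambda>j. M a (\<beta> j))) = c i \<otimes> leibniz_det I A" if i: "i \<in> I" for i
  proof -
    have "leibniz_det I (A(i := \<lambda>j. M a (\<beta> j)))
        = leibniz_det I (A(i := \<lambda>j. \<Oplus>l\<in>I. c l \<otimes> A l j))"
    proof (rule leibniz_det_cong)
      show "entries (A(i := \<lambda>j. \<Oplus>l\<in>I. c l \<otimes> A l j))"
        using A c by (auto simp: entries_def)
    next
      fix i' j assume "j \<in> I"
      then have "\<beta> j \<in> T" using I by auto
      then show "(A(i := \<lambda>j. M a (\<beta> j))) i' j = (A(i := \<lambda>j. \<Oplus>l\<in>I. c l \<otimes> A l j)) i' j"
        using row by (simp add: A_def)
    qed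
    also have "\<dots> = (\<Oplus>l\<in>I. c l \<otimes> leibniz_det I (A(i := A l)))"
      by (rule leibniz_det_row_lincomb[OF I(1) i A I(1) c A])
    \<comment> \<open>For \<open>l\<close> other than \<open>i\<close> the rows \<open>i\<close> and
      \<open>l\<close> coincide, so a single summand survives.\<close>
    also have "\<dots> = c i \<otimes> leibniz_det I (A(i := A i))"
    proof (rule finsum_kronecker[OF I(1) i])
      fix l
      have Al: "entries (A(i := A l))" using A by (auto simp: entries_def)
      show "c l \<otimes> leibniz_det I (A(i := A l)) \<in> carrier R" using c Al by simp
      assume "l \<in> I" "l \<noteq> i"
      then have "leibniz_det I (A(i := A l)) = \<zero>"
        using leibniz_det_identical_rows[OF I(1) i _ _ Al, of l] by simp
      then show "c l \<otimes> leibniz_det I (A(i := A l)) = \<zero>" using c by simp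
    qed
    finally show ?thesis by simp
  qed
  then have "(\<Oplus>i\<in>I. leibniz_det I (A(i := \<lambda>j. M a (\<beta> j))) \<otimes> M i b)
      = (\<Oplus>i\<in>I. leibniz_det I A \<otimes> (c i \<otimes> M i b))"
    using c A M by (intro finsum_cong' refl) (auto simp: m_ac)
  also have "\<dots> = leibniz_det I A \<otimes> (\<Oplus>i\<in>I. c i \<otimes> M i b)"
    using c A M I by (subst finsum_rdistr) auto
  finally show ?thesis using row[OF b] by simp
qed

subsection \<open>Zero patterns\<close>

definition monomial :: "'v set \<Rightarrow> ('v \<Rightarrow> nat) \<Rightarrow> ('v \<Rightarrow> 'a) \<Rightarrow> 'a" where
  "monomial V e x = (\<Otimes>v\<in>V. x v [^] e v)"

definition assignment :: "('v \<Rightarrow> 'a) \<Rightarrow> bool" where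
  "assignment x \<longleftrightarrow> (\<forall>v. x v \<in> carrier R)"

text \<open>The degree is bounded in each variable separately, which makes the number of monomials
  \<open>(D + 1)\<^bsup>\<bar>V\<bar>\<^esup>\<close>.\<close>

definition poly_fun :: "'v set \<Rightarrow> nat \<Rightarrow> (('v \<Rightarrow> 'a) \<Rightarrow> 'a) \<Rightarrow> bool" where
  "poly_fun V D f \<longleftrightarrow> (\<exists>c. assignment c \<and> (\<forall>x. assignment x \<longrightarrow>
     f x = (\<Oplus>e\<in>V \<rightarrow>\<^sub>E {..D}. c e \<otimes> monomial V e x)))"

lemma assignmentD [simp]: "assignment x \<Longrightarrow> x v \<in> carrier R"
  by (simp add: assignment_def)

lemma monomial_closed [simp]: "assignment x \<Longrightarrow> monomial V e x \<in> carrier R"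
  unfolding monomial_def by (intro finprod_closed) auto

lemma poly_fun_closed: "poly_fun V D f \<Longrightarrow> assignment x \<Longrightarrow> f x \<in> carrier R"
  unfolding poly_fun_def by (auto intro!: finsum_closed)

lemma poly_fun_cong:
  assumes "poly_fun V D f" "\<And>x. assignment x \<Longrightarrow> g x = f x"
  shows "poly_fun V D g"
  using assms unfolding poly_fun_def by metis

lemma poly_fun_zero: "poly_fun V D (\<lambda>x. \<zero>)"
  unfolding poly_fun_def
  by (intro exI[of _ "\<lambda>_. \<zero>"]) (auto simp: assignment_def finsum_zero)

lemma poly_fun_add:
  assumes "poly_fun V D f" "poly_fun V D g"
  shows "poly_fun V D (\<lambda>x. f x \<oplus> g x)"
proof -
  obtain c d where c: "assignment c" "\<And>x. assignment x \<Longrightarrow> f x = (\<Oplus>e\<in>V \<rightarrow>\<^sub>E {..D}. c e \<otimes> monomial V e x)"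
    and d: "assignment d" "\<And>x. assignment x \<Longrightarrow> g x = (\<Oplus>e\<in>V \<rightarrow>\<^sub>E {..D}. d e \<otimes> monomial V e x)"
    using assms unfolding poly_fun_def by blast
  have "f x \<oplus> g x = (\<Oplus>e\<in>V \<rightarrow>\<^sub>E {..D}. (c e \<oplus> d e) \<otimes> monomial V e x)" if x: "assignment x" for x
  proof -
    have "(\<Oplus>e\<in>V \<rightarrow>\<^sub>E {..D}. (c e \<oplus> d e) \<otimes> monomial V e x)
        = (\<Oplus>e\<in>V \<rightarrow>\<^sub>E {..D}. c e \<otimes> monomial V e x \<oplus> d e \<otimes> monomial V e x)"
      using c(1) d(1) x by (intro finsum_cong' refl) (auto simp: l_distr)
    also have "\<dots> = f x \<oplus> g x"
      unfolding c(2)[OF x] d(2)[OF x] using c(1) d(1) x by (intro finsum_addf) auto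
    finally show ?thesis by simp
  qed
  then show ?thesis unfolding poly_fun_def using c(1) d(1)
    by (intro exI[of _ "\<lambda>e. c e \<oplus> d e"]) (simp add: assignment_def)
qed

lemma poly_fun_finsum:
  fixes V :: "'v set"
  assumes "finite A" "\<And>a. a \<in> A \<Longrightarrow> poly_fun V D (f a)"
  shows "poly_fun V D (\<lambda>x. \<Oplus>a\<in>A. f a x)"
  using assms
proof (induct A)
  case empty
  show ?case by (simp add: poly_fun_zero)
next
  case (insert a A)
  have "poly_fun V D (\<lambda>x. f a x \<oplus> (\<Oplus>a\<in>A. f a x))"
    using insert by (intro poly_fun_add) auto
  then show ?case
  proof (rule poly_fun_cong)
    fix x :: "'v \<Rightarrow> 'a" assume "assignment x"
    then show "(\<Oplus>a\<in>insert a A. f a x) = f a x \<oplus> (\<Oplus>a\<in>A. f a x)"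
      using insert.hyps poly_fun_closed[OF insert.prems] by (intro finsum_insert) auto
  qed
qed

lemma poly_fun_monomial:
  assumes V: "finite V" and e: "e \<in> V \<rightarrow>\<^sub>E {..D}" and a: "a \<in> carrier R"
  shows "poly_fun V D (\<lambda>x. a \<otimes> monomial V e x)"
proof -
  have "(\<Oplus>e'\<in>V \<rightarrow>\<^sub>E {..D}. (if e' = e then a else \<zero>) \<otimes> monomial V e' x) = a \<otimes> monomial V e x"
    if x: "assignment x" for x
    using finsum_kronecker[of "V \<rightarrow>\<^sub>E {..D}" e "\<lambda>e'. (if e' = e then a else \<zero>) \<otimes> monomial V e' x"]
      V e a x by (auto intro!: finite_PiE)
  then show ?thesis unfolding poly_fun_def using a
    by (intro exI[of _ "\<lambda>e'. if e' = e then a else \<zero>"]) (auto simp: assignment_def)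
qed

lemma poly_fun_const:
  fixes V :: "'v set"
  assumes "finite V" "a \<in> carrier R"
  shows "poly_fun V D (\<lambda>x. a)"
proof (rule poly_fun_cong)
  show "poly_fun V D (\<lambda>x. a \<otimes> monomial V (\<lambda>v\<in>V. 0) x)"
    using assms by (intro poly_fun_monomial) auto
  fix x :: "'v \<Rightarrow> 'a" assume "assignment x"
  have "monomial V (\<lambda>v\<in>V. 0) x = \<one>"
    unfolding monomial_def by (intro finprod_one_eqI) auto
  then show "a = a \<otimes> monomial V (\<lambda>v\<in>V. 0) x" using assms by simp
qed

lemma poly_fun_var:
  fixes V :: "'v set"
  assumes "finite V" "v \<in> V"
  shows "poly_fun V 1 (\<lambda>x. x v)"
proof (rule poly_fun_cong)
  let ?e = "\<lambda>u\<in>V. if u = v then 1 else 0 :: nat"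
  show "poly_fun V 1 (\<lambda>x. \<one> \<otimes> monomial V ?e x)"
    using assms by (intro poly_fun_monomial) auto
  fix x :: "'v \<Rightarrow> 'a" assume x: "assignment x"
  have "monomial V ?e x = (\<Otimes>u\<in>V. if u = v then x u else \<one>)"
    unfolding monomial_def using x by (intro finprod_cong' refl) auto
  also have "\<dots> = x v" using assms x by (intro finprod_singleton_swap) auto
  finally show "x v = \<one> \<otimes> monomial V ?e x" using x by simp
qed

lemma monomial_mult:
  assumes "finite V" "assignment x"
  shows "monomial V e x \<otimes> monomial V e' x = monomial V (\<lambda>v\<in>V. e v + e' v) x"
proof -
  have "monomial V e x \<otimes> monomial V e' x = (\<Otimes>v\<in>V. x v [^] e v \<otimes> x v [^] e' v)"
    unfolding monomial_def using assms by (intro finprod_multf[symmetric]) auto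
  also have "\<dots> = monomial V (\<lambda>v\<in>V. e v + e' v) x"
    unfolding monomial_def using assms by (intro finprod_cong' refl) (auto simp: nat_pow_mult)
  finally show ?thesis .
qed

text \<open>Expand the product and add exponents variable by variable.
  \<open>poly_fun_finsum\<close> accepts the double sum without collecting equal exponents.\<close>

lemma poly_fun_mult:
  fixes V :: "'v set"
  assumes V: "finite V" and "poly_fun V D f" "poly_fun V D' g"
  shows "poly_fun V (D + D') (\<lambda>x. f x \<otimes> g x)"
proof -
  obtain c d where c: "assignment c" "\<And>x. assignment x \<Longrightarrow> f x = (\<Oplus>e\<in>V \<rightarrow>\<^sub>E {..D}. c e \<otimes> monomial V e x)"
    and d: "assignment d" "\<And>x. assignment x \<Longrightarrow> g x = (\<Oplus>e\<in>V \<rightarrow>\<^sub>E {..D'}. d e \<otimes> monomial V e x)"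
    using assms(2,3) unfolding poly_fun_def by blast
  have fin: "finite (V \<rightarrow>\<^sub>E {..D})" "finite (V \<rightarrow>\<^sub>E {..D'})" using V by (auto intro: finite_PiE)
  show ?thesis
  proof (rule poly_fun_cong)
    show "poly_fun V (D + D') (\<lambda>x. \<Oplus>e\<in>V \<rightarrow>\<^sub>E {..D}. \<Oplus>e'\<in>V \<rightarrow>\<^sub>E {..D'}.
        (c e \<otimes> d e') \<otimes> monomial V (\<lambda>v\<in>V. e v + e' v) x)"
    proof (intro poly_fun_finsum fin poly_fun_monomial V)
      fix e e' assume "e \<in> V \<rightarrow>\<^sub>E {..D}" "e' \<in> V \<rightarrow>\<^sub>E {..D'}"
      then show "(\<lambda>v\<in>V. e v + e' v) \<in> V \<rightarrow>\<^sub>E {..D + D'}"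
        by (auto simp: PiE_iff add_mono)
    qed (use c d in auto)
    fix x :: "'v \<Rightarrow> 'a" assume x: "assignment x"
    have "f x \<otimes> g x = (\<Oplus>e\<in>V \<rightarrow>\<^sub>E {..D}. (c e \<otimes> monomial V e x) \<otimes> g x)"
      unfolding c(2)[OF x] using c(1) fin x poly_fun_closed[OF assms(3) x] by (intro finsum_ldistr) auto
    also have "\<dots> = (\<Oplus>e\<in>V \<rightarrow>\<^sub>E {..D}. \<Oplus>e'\<in>V \<rightarrow>\<^sub>E {..D'}.
        (c e \<otimes> d e') \<otimes> monomial V (\<lambda>v\<in>V. e v + e' v) x)"
    proof (intro finsum_cong' refl)
      fix e
      have "(c e \<otimes> monomial V e x) \<otimes> g x
          = (\<Oplus>e'\<in>V \<rightarrow>\<^sub>E {..D'}. (c e \<otimes> monomial V e x) \<otimes> (d e' \<otimes> monomial V e' x))"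
        unfolding d(2)[OF x] using c(1) d(1) fin x by (intro finsum_rdistr) auto
      also have "\<dots> = (\<Oplus>e'\<in>V \<rightarrow>\<^sub>E {..D'}. (c e \<otimes> d e') \<otimes> monomial V (\<lambda>v\<in>V. e v + e' v) x)"
        using c(1) d(1) x by (intro finsum_cong' refl) (auto simp: monomial_mult[OF V x, symmetric] m_ac)
      finally show "(c e \<otimes> monomial V e x) \<otimes> g x
          = (\<Oplus>e'\<in>V \<rightarrow>\<^sub>E {..D'}. (c e \<otimes> d e') \<otimes> monomial V (\<lambda>v\<in>V. e v + e' v) x)" .
    qed (use c d x in \<open>auto intro!: finsum_closed\<close>)
    finally show "f x \<otimes> g x = (\<Oplus>e\<in>V \<rightarrow>\<^sub>E {..D}. \<Oplus>e'\<in>V \<rightarrow>\<^sub>E {..D'}.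
        (c e \<otimes> d e') \<otimes> monomial V (\<lambda>v\<in>V. e v + e' v) x)" .
  qed
qed

lemma poly_fun_finprod:
  fixes V :: "'v set"
  assumes V: "finite V" and "finite A" "\<And>a. a \<in> A \<Longrightarrow> poly_fun V D (f a)"
  shows "poly_fun V (card A * D) (\<lambda>x. \<Otimes>a\<in>A. f a x)"
  using assms(2,3)
proof (induct A)
  case empty
  show ?case using poly_fun_const[OF V one_closed] by simp
next
  case (insert a A)
  have "poly_fun V (D + card A * D) (\<lambda>x. f a x \<otimes> (\<Otimes>a\<in>A. f a x))"
    using insert by (intro poly_fun_mult V) auto
  then have "poly_fun V (D + card A * D) (\<lambda>x. \<Otimes>a\<in>insert a A. f a x)"
  proof (rule poly_fun_cong)
    fix x :: "'v \<Rightarrow> 'a" assume "assignment x"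
    then show "(\<Otimes>a\<in>insert a A. f a x) = f a x \<otimes> (\<Otimes>a\<in>A. f a x)"
      using insert.hyps poly_fun_closed[OF insert.prems] by (intro finprod_insert) auto
  qed
  then show ?case using insert.hyps by simp
qed

section \<open>Counting zero patterns of polynomial functions\<close>

lemma finprod_eq_zero_iff:
  assumes "finite B" "\<And>b. b \<in> B \<Longrightarrow> f b \<in> carrier R"
  shows "(\<Otimes>b\<in>B. f b) = \<zero> \<longleftrightarrow> (\<exists>b\<in>B. f b = \<zero>)"
  using assms
proof (induct B)
  case (insert b B)
  have "(\<Otimes>b\<in>insert b B. f b) = f b \<otimes> (\<Otimes>b\<in>B. f b)"
    using insert by (intro finprod_insert) auto
  moreover have "(\<Otimes>b\<in>B. f b) \<in> carrier R" using insert.prems by (intro finprod_closed) auto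
  ultimately show ?case using insert integral_iff[of "f b" "\<Otimes>b\<in>B. f b"] by auto
qed simp

text \<open>Ronyai, Babai and Ganapathy: for a zero pattern \<open>Z\<close>, the product of the functions that do not
  vanish on \<open>Z\<close> is nonzero at a witness of another pattern only if that pattern contains \<open>Z\<close>. So these
  products are linearly independent, and they live in a space spanned by few monomials.\<close>

lemma card_zero_patterns_le:
  assumes V: "finite V" and B: "finite B" and h: "\<And>b. b \<in> B \<Longrightarrow> poly_fun V D (h b)"
    and Z: "\<And>Z. Z \<in> \<Z> \<Longrightarrow> \<exists>x. assignment x \<and> Z = {b\<in>B. h b x \<noteq> \<zero>}"
  shows "card \<Z> \<le> (card B * D + 1) ^ card V"
proof -
  have "\<Z> \<subseteq> Pow B" using Z by blast
  then have finZ: "finite \<Z>" using B by (meson finite_Pow_iff finite_subset)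
  obtain pt where pt: "\<And>Z. Z \<in> \<Z> \<Longrightarrow> assignment (pt Z)" "\<And>Z. Z \<in> \<Z> \<Longrightarrow> Z = {b\<in>B. h b (pt Z) \<noteq> \<zero>}"
    using Z by metis
  define E where "E = V \<rightarrow>\<^sub>E {..card B * D}"
  have finE: "finite E" using V by (auto simp: E_def intro: finite_PiE)
  have cardE: "card E = (card B * D + 1) ^ card V" using V by (simp add: E_def card_PiE)
  \<comment> \<open>The factor one outside \<open>Z\<close> lets each product run over all of
    \<open>B\<close>, so one degree bound serves all patterns.\<close>
  define g where "g Z x = (\<Otimes>b\<in>B. if b \<in> Z then h b x else \<one>)" for Z x
  have "poly_fun V D (\<lambda>x. if b \<in> Z then h b x else \<one>)" if "b \<in> B" for b Z
    using h[OF that] poly_fun_const[OF V one_closed] by (cases "b \<in> Z") simp_all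
  then have g: "poly_fun V (card B * D) (g Z)" for Z
    unfolding g_def[abs_def] by (rule poly_fun_finprod[OF V B])
  then have "\<exists>c. assignment c \<and> (\<forall>x. assignment x \<longrightarrow> g Z x = (\<Oplus>e\<in>E. c e \<otimes> monomial V e x))" for Z
    unfolding poly_fun_def E_def .
  then obtain cf where cf: "\<And>Z. assignment (cf Z)"
    "\<And>Z x. assignment x \<Longrightarrow> g Z x = (\<Oplus>e\<in>E. cf Z e \<otimes> monomial V e x)"
    by metis
  have g_zero: "g Z (pt Z') = \<zero> \<longleftrightarrow> \<not> Z \<subseteq> Z'" if "Z \<in> \<Z>" "Z' \<in> \<Z>" for Z Z'
  proof -
    have "g Z (pt Z') = \<zero> \<longleftrightarrow> (\<exists>b\<in>B. (if b \<in> Z then h b (pt Z') else \<one>) = \<zero>)"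
      unfolding g_def using B poly_fun_closed[OF h] pt(1)[OF that(2)] by (intro finprod_eq_zero_iff) auto
    also have "\<dots> \<longleftrightarrow> \<not> Z \<subseteq> Z'"
      using pt(2)[OF that(2)] \<open>\<Z> \<subseteq> Pow B\<close> that(1) by (auto split: if_splits)
    finally show ?thesis .
  qed
  \<comment> \<open>Patterns index the columns and exponents the rows: each column is the
    coefficient vector of one product, and its length is \<open>card E\<close>.\<close>
  have "lin_indep E (mtrans cf) \<Z>"
    unfolding lin_indep_def
  proof (intro allI impI)
    fix c assume c: "\<forall>Z. c Z \<in> carrier R" "\<forall>e\<in>E. (\<Oplus>Z\<in>\<Z>. c Z \<otimes> mtrans cf e Z) = \<zero>"
    have van: "(\<Oplus>Z\<in>\<Z>. c Z \<otimes> g Z x) = \<zero>" if x: "assignment x" for x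
    proof -
      have "(\<Oplus>Z\<in>\<Z>. c Z \<otimes> g Z x) = (\<Oplus>e\<in>E. (\<Oplus>Z\<in>\<Z>. c Z \<otimes> cf Z e) \<otimes> monomial V e x)"
        unfolding cf(2)[OF x] using c(1) cf(1) x finZ finE by (intro finsum_rotate) auto
      also have "\<dots> = \<zero>"
        using c(2) x by (intro add.finprod_one_eqI) (simp add: mtrans_def)
      finally show ?thesis .
    qed
    show "\<forall>Z\<in>\<Z>. c Z = \<zero>"
    proof (rule ccontr)
      assume "\<not> (\<forall>Z\<in>\<Z>. c Z = \<zero>)"
      then have "{Z\<in>\<Z>. c Z \<noteq> \<zero>} \<noteq> {}" by auto
      \<comment> \<open>At the witness of an inclusion-minimal pattern with nonzero coefficient all
        other terms vanish: the coefficient is zero or the pattern is not contained in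
        \<open>Z\<close>.\<close>
      then obtain Z where Z: "Z \<in> {Z\<in>\<Z>. c Z \<noteq> \<zero>}" "\<forall>Z'\<in>{Z\<in>\<Z>. c Z \<noteq> \<zero>}. Z' \<subseteq> Z \<longrightarrow> Z = Z'"
        using finite_has_minimal[of "{Z\<in>\<Z>. c Z \<noteq> \<zero>}"] finZ by auto
      have gc: "g Z' (pt Z) \<in> carrier R" for Z'
        using Z(1) pt(1) poly_fun_closed[OF g] by auto
      have "(\<Oplus>Z'\<in>\<Z>. c Z' \<otimes> g Z' (pt Z)) = c Z \<otimes> g Z (pt Z)"
      proof (rule finsum_kronecker[OF finZ])
        fix Z' assume "Z' \<in> \<Z>" "Z' \<noteq> Z"
        then have "c Z' = \<zero> \<or> g Z' (pt Z) = \<zero>" using Z g_zero by auto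
        then show "c Z' \<otimes> g Z' (pt Z) = \<zero>" using c(1) gc by auto
      qed (use Z gc c(1) in auto)
      moreover have "g Z (pt Z) \<noteq> \<zero>" using g_zero Z by auto
      ultimately show False
        using van[OF pt(1)] Z(1) integral[of "c Z" "g Z (pt Z)"] c(1) gc by auto
    qed
  qed
  moreover have "entries (mtrans cf)" using cf(1) by (simp add: entries_def mtrans_def)
  ultimately show ?thesis
    using lin_indep_card_le[OF finE finZ] cardE by simp
qed

section \<open>Zero patterns of matrices with prescribed bases\<close>

lemma poly_fun_leibniz_det:
  assumes V: "finite V" and I: "finite I" and A: "\<And>i j. poly_fun V 1 (\<lambda>x. A x i j)"
  shows "poly_fun V (card I) (\<lambda>x. leibniz_det I (A x))"
proof -
  have "poly_fun V (0 + card I * 1) (\<lambda>x. perm_sign p \<otimes> (\<Otimes>i\<in>I. A x i (p i)))" for p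
    using A by (intro poly_fun_mult V poly_fun_const poly_fun_finprod I perm_sign_closed)
  then show ?thesis
    unfolding leibniz_det_def using I by (intro poly_fun_finsum finite_permutations) auto
qed

text \<open>Prescribing \<open>V\<close> forces the remaining entries of the basis rows and columns
  to be zero, which leaves \<open>card V\<close> unknowns.\<close>

definition basis_patterns :: "'i set \<Rightarrow> 'i set \<Rightarrow> 'i set \<Rightarrow> ('i \<times> 'i) set \<Rightarrow> ('i \<times> 'i) set set" where
  "basis_patterns T I J V = {Z. \<exists>M. entries M \<and> basis_of T (mtrans M) T I \<and> basis_of T M T J \<and>
     Z = {(i, j)\<in>T \<times> T. M i j \<noteq> \<zero>} \<and> V = {(i, j)\<in>T \<times> T. M i j \<noteq> \<zero> \<and> (i \<in> I \<or> j \<in> J)}}"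

lemma basis_patterns_subset: "basis_patterns T I J V \<subseteq> Pow (T \<times> T)"
  by (auto simp: basis_patterns_def)

text \<open>The basis rows and columns determine the matrix: by Cramer's rule each entry, times the
  determinant of the minor on \<open>I\<close> and \<open>J\<close>, is a polynomial in the entries
  on \<open>V\<close>. The determinants contribute degree \<open>card I\<close> and the factor from
  a basis row one more.\<close>

lemma card_basis_patterns:
  fixes V :: "('i \<times> 'i) set"
  assumes T: "finite T" and V: "finite V"
  shows "card (basis_patterns T I J V) \<le> (card (T \<times> T) * (card I + 1) + 1) ^ card V"
proof (cases "basis_patterns T I J V = {}")
  case False
  then obtain M0 where M0: "entries M0" "basis_of T (mtrans M0) T I" "basis_of T M0 T J"
    unfolding basis_patterns_def by blast
  then have IJ: "I \<subseteq> T" "J \<subseteq> T" "card I = card J"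
    using card_row_basis[OF T T M0] by (auto simp: basis_of_def)
  have fin: "finite I" "finite J" using IJ T finite_subset by auto
  \<comment> \<open>The bijection turns the minor with rows \<open>I\<close> and columns
    \<open>J\<close> into a square matrix indexed by \<open>I\<close>, as \<open>leibniz_det\<close>
    requires.\<close>
  obtain \<beta> where \<beta>: "bij_betw \<beta> I J" using IJ(3) fin finite_same_card_bij by blast
  have \<beta>J: "\<beta> ` I = J" using \<beta> by (simp add: bij_betw_def)
  \<comment> \<open>Variables on \<open>V\<close>, zero elsewhere. Within \<open>T\<close> this
    agrees with \<open>M\<close> on the basis rows and columns, and for positions in
    \<open>T \<times> T\<close> the function \<open>h\<close> reads no other entries.\<close>
  define X where "X x i j = (if (i, j) \<in> V then x (i, j) else \<zero>)" for x :: "'i \<times> 'i \<Rightarrow> 'a" and i j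
  \<comment> \<open>Cramer numerators: row \<open>i\<close> of the minor is replaced by the row that
    contains the position \<open>b\<close>.\<close>
  define h where "h b x = (\<Oplus>i\<in>I. leibniz_det I ((\<lambda>i j. X x i (\<beta> j))(i := \<lambda>j. X x (fst b) (\<beta> j)))
      \<otimes> X x i (snd b))" for b x
  have X: "poly_fun V 1 (\<lambda>x. X x i j)" for i j
    unfolding X_def using poly_fun_var[OF V, of "(i, j)"] poly_fun_zero[of V 1]
    by (cases "(i, j) \<in> V") simp_all
  show ?thesis
  proof (rule card_zero_patterns_le[OF V, of "T \<times> T" "card I + 1" h])
    show "finite (T \<times> T)" using T by simp
    have "poly_fun V 1 (\<lambda>x. ((\<lambda>i j. X x i (\<beta> j))(i := \<lambda>j. X x (fst b) (\<beta> j))) k j)" for i b k j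
      using X by (cases "k = i") auto
    then show "poly_fun V (card I + 1) (h b)" for b
      unfolding h_def[abs_def] by (intro poly_fun_finsum fin poly_fun_mult V poly_fun_leibniz_det X)
    fix Z assume "Z \<in> basis_patterns T I J V"
    then obtain M where M: "entries M" and bI: "basis_of T (mtrans M) T I" and bJ: "basis_of T M T J"
      and Z: "Z = {(i, j)\<in>T \<times> T. M i j \<noteq> \<zero>}"
      and VM: "V = {(i, j)\<in>T \<times> T. M i j \<noteq> \<zero> \<and> (i \<in> I \<or> j \<in> J)}"
      unfolding basis_patterns_def by blast
    define x where "x v = M (fst v) (snd v)" for v
    have x: "assignment x" using M by (simp add: assignment_def x_def)
    have XM: "X x i j = M i j" if "i \<in> T" "j \<in> T" "i \<in> I \<or> j \<in> J" for i j
      using that by (auto simp: X_def x_def VM)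
    define A where "A i j = M i (\<beta> j)" for i j
    have A: "entries A" using M by (simp add: A_def entries_def)
    \<comment> \<open>The rows \<open>I\<close> are independent on all columns of \<open>T\<close>,
      which the columns \<open>J\<close> span, so they are independent on \<open>J\<close> already.
      Hence the minor is nonsingular.\<close>
    have "spans T (mtrans (mtrans M)) J T"
      using basis_of_spans[OF T M bJ] by simp
    then have ind: "lin_indep J (mtrans M) I"
      by (rule lin_indep_rows_basis[OF fin entries_mtrans[OF M]]) (use bI IJ in \<open>auto simp: basis_of_def\<close>)
    have "lin_indep I (mtrans A) I"
      unfolding lin_indep_def
    proof (intro allI impI)
      fix c assume c: "\<forall>i. c i \<in> carrier R" "\<forall>j\<in>I. (\<Oplus>i\<in>I. c i \<otimes> mtrans A j i) = \<zero>"
      have "\<forall>j\<in>J. (\<Oplus>i\<in>I. c i \<otimes> mtrans M j i) = \<zero>"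
        using c(2) unfolding \<beta>J[symmetric] by (simp add: mtrans_def A_def)
      then show "\<forall>i\<in>I. c i = \<zero>" by (rule lin_indepD[OF ind c(1)])
    qed
    then have detA: "leibniz_det I A \<noteq> \<zero>" by (rule leibniz_det_nonzero[OF fin(1) A])
    obtain d where d: "\<And>u i. d u i \<in> carrier R"
      "\<And>u b. u \<in> T \<Longrightarrow> b \<in> T \<Longrightarrow> M u b = (\<Oplus>i\<in>I. d u i \<otimes> M i b)"
      using basis_of_spans[OF T entries_mtrans[OF M] bI] unfolding spans_def mtrans_def by blast
    have "h (a, b) x = leibniz_det I A \<otimes> M a b" if ab: "a \<in> T" "b \<in> T" for a b
    proof -
      have "h (a, b) x = (\<Oplus>i\<in>I. leibniz_det I (A(i := \<lambda>j. M a (\<beta> j))) \<otimes> M i b)"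
        unfolding h_def fst_conv snd_conv
      proof (intro finsum_cong' refl)
        show "(\<lambda>i. leibniz_det I (A(i := \<lambda>j. M a (\<beta> j))) \<otimes> M i b) \<in> I \<rightarrow> carrier R"
          using A M by (auto simp: entries_def intro!: m_closed leibniz_det_closed)
        fix i assume i: "i \<in> I"
        have "leibniz_det I ((\<lambda>i j. X x i (\<beta> j))(i := \<lambda>j. X x a (\<beta> j)))
            = leibniz_det I (A(i := \<lambda>j. M a (\<beta> j)))"
          using A M IJ \<beta>J ab
          by (intro leibniz_det_cong) (auto simp: entries_def A_def intro!: XM)
        then show "leibniz_det I ((\<lambda>i j. X x i (\<beta> j))(i := \<lambda>j. X x a (\<beta> j))) \<otimes> X x i b
            = leibniz_det I (A(i := \<lambda>j. M a (\<beta> j))) \<otimes> M i b"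
          using XM[of i b] i IJ(1) ab by auto
      qed
      also have "\<dots> = leibniz_det I A \<otimes> M a b"
        unfolding A_def[abs_def]
        using \<beta>J IJ(2) d(2)[OF ab(1)] ab by (intro entry_via_basis_rows[OF fin(1) _ M d(1)[of a]]) auto
      finally show ?thesis .
    qed
    \<comment> \<open>The determinant is nonzero and common to all positions, so it does not alter
      the pattern.\<close>
    then have "h (a, b) x = \<zero> \<longleftrightarrow> M a b = \<zero>" if "a \<in> T" "b \<in> T" for a b
      using that detA A M integral_iff[of "leibniz_det I A" "M a b"] by auto
    then have "Z = {b\<in>T \<times> T. h b x \<noteq> \<zero>}"
      unfolding Z by auto
    with x show "\<exists>x. assignment x \<and> Z = {b\<in>T \<times> T. h b x \<noteq> \<zero>}" by blast
  qed
qed simp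

subsection \<open>Random graphs\<close>

lemma mat_rank_bounds:
  shows card_le_mat_rank: "S \<subseteq> {..<n} \<Longrightarrow> cols_indep R n M S \<Longrightarrow> card S \<le> mat_rank R n M"
    and mat_rank_le: "mat_rank R n M \<le> n"
proof -
  let ?C = "{card S | S. S \<subseteq> {..<n} \<and> cols_indep R n M S}"
  have sub: "?C \<subseteq> {..n}"
    using card_mono[of "{..<n}"] by auto
  then have fin: "finite ?C" using finite_subset by blast
  show "card S \<le> mat_rank R n M" if "S \<subseteq> {..<n}" "cols_indep R n M S"
    unfolding mat_rank_def using fin by (rule Max_ge) (use that in blast)
  have "card {} \<in> ?C" by (intro CollectI exI[of _ "{}"]) (simp add: cols_indep_def)
  then have "Max ?C \<in> ?C" using fin by (intro Max_in) auto
  then show "mat_rank R n M \<le> n" unfolding mat_rank_def using sub by blast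
qed

lemma minrank_attained:
  obtains M where "represents R n adj M" "mat_rank R n M = minrank R n adj"
proof -
  let ?C = "{mat_rank R n M | M. represents R n adj M}"
  have "?C \<subseteq> {..n}" using mat_rank_le by blast
  then have "finite ?C" using finite_subset by blast
  \<comment> \<open>The identity matrix represents every graph, so the minimum is over a nonempty
    set.\<close>
  moreover have "represents R n adj (\<lambda>i j. if i = j then \<one> else \<zero>)"
    by (auto simp: represents_def matrix_over_def)
  then have "?C \<noteq> {}" by blast
  ultimately have "Min ?C \<in> ?C" by (rule Min_in)
  then show thesis using that unfolding minrank_def by auto
qed

text \<open>\<open>cols_indep\<close> takes coefficients that lie in the carrier only on
  \<open>S\<close>, whereas \<open>lin_indep\<close> speaks of total families; extension by zero
  reconciles them.\<close>

lemma lin_indep_imp_cols_indep: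
  assumes S: "S \<subseteq> {..<n}" and M: "\<And>i j. i < n \<Longrightarrow> j < n \<Longrightarrow> M' i j = M i j" "entries M'"
    and ind: "lin_indep {..<n} M' S"
  shows "cols_indep R n M S"
  unfolding cols_indep_def
proof (intro allI impI)
  fix c assume c: "\<forall>j\<in>S. c j \<in> carrier R" "\<forall>i<n. (\<Oplus>j\<in>S. c j \<otimes> M i j) = \<zero>"
  define c' where "c' j = (if j \<in> S then c j else \<zero>)" for j
  have c': "\<forall>j. c' j \<in> carrier R" using c by (simp add: c'_def)
  have "(\<Oplus>j\<in>S. c' j \<otimes> M' i j) = \<zero>" if i: "i < n" for i
  proof -
    have "(\<Oplus>j\<in>S. c j \<otimes> M i j) = (\<Oplus>j\<in>S. c' j \<otimes> M' i j)"
    proof (intro finsum_cong' refl)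
      fix j assume j: "j \<in> S"
      then have "j < n" using S by auto
      then show "c j \<otimes> M i j = c' j \<otimes> M' i j" using M(1)[OF i] j by (simp add: c'_def)
    qed (use c' M(2) in auto)
    then show ?thesis using c(2) i by simp
  qed
  then have "\<forall>j\<in>S. c' j = \<zero>" by (intro lin_indepD[OF ind c']) auto
  then show "\<forall>j\<in>S. c j = \<zero>" by (simp add: c'_def)
qed

text \<open>The deterministic core: a matrix attaining the minrank of any graph yields the data over
  which the union bound later runs.\<close>

lemma minrank_sparse_pattern:
  assumes n: "n > 0"
  obtains T I J V Z where "T \<subseteq> {..<n}" "I \<subseteq> T" "J \<subseteq> T" "V \<subseteq> T \<times> T" "V \<noteq> {}" "snd ` V = T"
    "Z \<in> basis_patterns T I J V" "\<forall>(i, j)\<in>Z. i \<noteq> j \<longrightarrow> adj i j"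
    "card T * card V \<le> 2 * card I * card Z" "card I * n \<le> minrank R n adj * card T"
proof -
  obtain M where rep: "represents R n adj M" and rk: "mat_rank R n M = minrank R n adj"
    by (rule minrank_attained)
  \<comment> \<open>Entries of \<open>M\<close> outside the index range are unrestricted; zero there
    makes \<open>entries\<close> hold.\<close>
  define M' where "M' i j = (if i < n \<and> j < n then M i j else \<zero>)" for i j
  have M': "entries M'" and diag: "\<And>i. i < n \<Longrightarrow> M' i i \<noteq> \<zero>"
    and off: "\<And>i j. i < n \<Longrightarrow> j < n \<Longrightarrow> i \<noteq> j \<Longrightarrow> M' i j \<noteq> \<zero> \<Longrightarrow> adj i j"
    using rep by (auto simp: entries_def M'_def represents_def matrix_over_def)
  obtain J0 where J0: "basis_of {..<n} M' {..<n} J0" using basis_of_exists by blast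
  then have J0': "J0 \<subseteq> {..<n}" "lin_indep {..<n} M' J0" by (auto simp: basis_of_def)
  have "cols_indep R n M J0"
    using lin_indep_imp_cols_indep[OF J0'(1) _ M' J0'(2), of M] by (simp add: M'_def)
  then have rk0: "card J0 \<le> minrank R n adj"
    unfolding rk[symmetric] using J0'(1) by (intro card_le_mat_rank)
  have "finite {..<n}" "{..<n} \<noteq> {}" using n by auto
  from this M' J0 obtain T I J where T: "T \<subseteq> {..<n}" "T \<noteq> {}"
    and bI: "basis_of T (mtrans M') T I" and bJ: "basis_of T M' T J"
    and ratio: "card J * card {..<n} \<le> card J0 * card T"
    and wI: "card T * (\<Sum>i\<in>I. card {j\<in>T. M' i j \<noteq> \<zero>}) \<le> card J * card {(i,j)\<in>T \<times> T. M' i j \<noteq> \<zero>}"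
    and wJ: "card T * (\<Sum>j\<in>J. card {i\<in>T. M' i j \<noteq> \<zero>}) \<le> card J * card {(i,j)\<in>T \<times> T. M' i j \<noteq> \<zero>}"
    by (rule sparse_principal_submatrix)
  have finT: "finite T" using T finite_subset by blast
  have IJ: "I \<subseteq> T" "J \<subseteq> T" using bI bJ by (auto simp: basis_of_def)
  have cIJ: "card I = card J" by (rule card_row_basis[OF finT finT M' bI bJ])
  define Z where "Z = {(i, j)\<in>T \<times> T. M' i j \<noteq> \<zero>}"
  define V where "V = {(i, j)\<in>T \<times> T. M' i j \<noteq> \<zero> \<and> (i \<in> I \<or> j \<in> J)}"
  have dT: "\<And>i. i \<in> T \<Longrightarrow> M' i i \<noteq> \<zero>" using diag T by auto
  have V: "card T * card V \<le> 2 * (card J * card Z)" "snd ` V = T"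
    unfolding V_def Z_def by (rule support_of_bases[OF finT M' dT bI IJ(2) wI wJ]; assumption)+
  show thesis
  proof (rule that)
    show "Z \<in> basis_patterns T I J V"
      using M' bI bJ Z_def V_def unfolding basis_patterns_def by blast
    show "card I * n \<le> minrank R n adj * card T"
      using order_trans[OF ratio mult_le_mono1[OF rk0]] by (simp add: cIJ)
    show "\<forall>(i, j)\<in>Z. i \<noteq> j \<longrightarrow> adj i j"
      using off T(1) by (auto simp: Z_def)
    show "V \<noteq> {}" using V(2) T(2) by auto
    show "card T * card V \<le> 2 * card I * card Z" using V(1) cIJ by simp
  qed (use T IJ V in \<open>auto simp: V_def\<close>)
qed

end

section \<open>Edge probabilities in the binomial random graph\<close>

lemma finite_vertex_pairs: "finite (vertex_pairs n)"
  by (rule finite_subset[of _ "{..<n} \<times> {..<n}"]) (auto simp: vertex_pairs_def)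

lemma prob_gnp_edges:
  assumes "E \<subseteq> vertex_pairs n" "0 \<le> p" "p \<le> 1"
  shows "measure_pmf.prob (gnp n p) {f. \<forall>e\<in>E. f e} = p ^ card E"
proof -
  have "{f. \<forall>e\<in>E. f e} = Pi (vertex_pairs n) (\<lambda>e. if e \<in> E then {True} else UNIV)"
    using assms(1) by (auto simp: Pi_def)
  then have "measure_pmf.prob (gnp n p) {f. \<forall>e\<in>E. f e}
      = (\<Prod>e\<in>vertex_pairs n. measure_pmf.prob (bernoulli_pmf p) (if e \<in> E then {True} else UNIV))"
    unfolding gnp_def by (simp add: measure_Pi_pmf_Pi finite_vertex_pairs)
  also have "\<dots> = (\<Prod>e\<in>vertex_pairs n. if e \<in> E then p else 1)"
    using assms by (intro prod.cong) (auto simp: measure_pmf_single)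
  also have "\<dots> = p ^ card E"
    using assms(1) finite_vertex_pairs[of n] by (simp add: prod.If_cases Int_absorb1)
  finally show ?thesis .
qed

text \<open>Each edge is covered by at most two off-diagonal entries of the pattern \<open>Z\<close>.\<close>

lemma prob_pattern_le:
  assumes T: "T \<subseteq> {..<n}" and Z: "Z \<subseteq> T \<times> T" and p: "0 \<le> p" "p \<le> 1"
  obtains e where "card Z \<le> 2 * e + card T"
    "measure_pmf.prob (gnp n p) {f. \<forall>(i, j)\<in>Z. i \<noteq> j \<longrightarrow> adj_of f i j} = p ^ e"
proof -
  have finT: "finite T" using T finite_subset by blast
  then have finZ: "finite Z" using Z by (meson finite_SigmaI finite_subset)
  \<comment> \<open>The smaller vertex comes first, so two mirrored positions of \<open>Z\<close>
    give the same element of \<open>E\<close>.\<close>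
  define E where "E = (\<lambda>(i, j). (min i j, max i j)) ` {(i, j)\<in>Z. i \<noteq> j}"
  have finE: "finite E" unfolding E_def using finZ by (auto intro: finite_subset)
  have EV: "E \<subseteq> vertex_pairs n"
  proof -
    have "Z \<subseteq> {..<n} \<times> {..<n}" using T Z by blast
    then show ?thesis by (auto simp: E_def vertex_pairs_def)
  qed
  have "Z \<subseteq> (E \<union> prod.swap ` E) \<union> (\<lambda>i. (i, i)) ` T"
  proof
    fix z assume z: "z \<in> Z"
    obtain i j where ij: "z = (i, j)" by (cases z)
    show "z \<in> (E \<union> prod.swap ` E) \<union> (\<lambda>i. (i, i)) ` T"
    proof (cases "i = j")
      case False
      then have "(min i j, max i j) \<in> E" using z ij by (force simp: E_def)
      then have "z \<in> E \<or> prod.swap z \<in> E" using ij by (auto simp: min_def max_def split: if_splits)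
      then have "z \<in> E \<or> z \<in> prod.swap ` E" by (metis image_eqI swap_swap)
      then show ?thesis by blast
    qed (use z ij Z in auto)
  qed
  then have "card Z \<le> card ((E \<union> prod.swap ` E) \<union> (\<lambda>i. (i, i)) ` T)"
    using finE finT by (intro card_mono) auto
  also have "\<dots> \<le> card E + card (prod.swap ` E) + card ((\<lambda>i. (i, i)) ` T)"
    by (meson add_le_mono1 card_Un_le order_trans)
  also have "\<dots> \<le> card E + card E + card T"
    using finE finT by (intro add_mono card_image_le) auto
  finally have "card Z \<le> 2 * card E + card T" by simp
  moreover have "{f. \<forall>(i, j)\<in>Z. i \<noteq> j \<longrightarrow> adj_of f i j} = {f. \<forall>e\<in>E. f e}"
    by (auto simp: E_def adj_of_def)
  ultimately show thesis using that prob_gnp_edges[OF EV p] by simp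
qed

text \<open>With \<open>l = ln (1 / p)\<close> and \<open>L = ln n\<close>, \<open>ratio\<close> and
  \<open>sparse\<close> combine to \<open>40 * L * v\<close> at most \<open>l * s\<close>. By
  \<open>edges\<close> this is at most \<open>2 * e * l + t * l\<close>, where the last term, due to
  the diagonal, is at most \<open>v * L\<close>.\<close>

lemma edge_probability_le:
  fixes p :: real
  assumes n: "n \<ge> 2" and p: "1 / real n \<le> p"
    and tv: "t \<le> v" and t0: "t > 0" and sparse: "t * v \<le> 2 * k * s"
    and ratio: "80 * real k * ln (real n) \<le> real t * ln (1 / p)"
    and edges: "s \<le> 2 * e + t"
  shows "p ^ e \<le> (1 / real n ^ 19) ^ v"
proof -
  define l where "l = ln (1 / p)"
  define L where "L = ln (real n)"
  have p0: "p > 0" using p n by (smt (verit) divide_pos_pos of_nat_0_less_iff zero_less_numeral order_less_le_trans)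
  have L: "L > 0" using n by (simp add: L_def)
  have lp: "l = - ln p" using p0 by (simp add: l_def ln_div)
  \<comment> \<open>The lower bound on \<open>p\<close> gives \<open>l\<close> at most
    \<open>L\<close>, which controls the loss from the diagonal.\<close>
  have "ln (1 / real n) \<le> ln p" using p p0 n by simp
  then have lL: "l \<le> L" using n by (simp add: lp L_def ln_div)
  have "real k * (80 * L) \<ge> 0" using L by simp
  then have "real t * l \<ge> 0" using ratio by (simp add: l_def L_def mult_ac)
  then have l0: "l \<ge> 0" using t0 by (simp add: zero_le_mult_iff)
  have "real t * (40 * L * real v) \<le> real t * (l * real s)"
  proof -
    have "real (t * v) \<le> real (2 * k * s)" using sparse by (simp only: of_nat_le_iff)
    then have "40 * L * (real t * real v) \<le> 40 * L * (2 * real k * real s)"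
      using L by (intro mult_left_mono) auto
    also have "\<dots> = (80 * real k * L) * real s" by simp
    also have "\<dots> \<le> (real t * l) * real s"
      using ratio by (intro mult_right_mono) (auto simp: l_def L_def)
    finally show ?thesis by (simp add: mult_ac)
  qed
  then have "40 * L * real v \<le> l * real s" using t0 by simp
  also have "\<dots> \<le> l * (2 * real e + real t)"
    using edges l0 by (intro mult_left_mono) linarith+
  also have "\<dots> \<le> 2 * real e * l + real v * L"
  proof -
    have "l * real t \<le> L * real v" using lL l0 tv by (intro mult_mono) auto
    then show ?thesis by (simp add: algebra_simps)
  qed
  finally have "40 * (real v * L) \<le> 2 * (real e * l) + real v * L" by (simp add: mult_ac)
  moreover have "real v * L \<ge> 0" using L by simp
  \<comment> \<open>The inequality gives 39/2, rounded down to 19.\<close>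
  ultimately have main: "19 * real v * L \<le> real e * l" by linarith
  have "p ^ e = exp (- (real e * l))"
    using p0 by (simp add: lp exp_of_nat_mult)
  also have "\<dots> \<le> exp (- (19 * real v * L))" using main by simp
  also have "\<dots> = (1 / real n ^ 19) ^ v"
  proof -
    have "exp (real v * (- 19 * L)) = exp (- 19 * L) ^ v" by (rule exp_of_nat_mult)
    moreover have "exp (- 19 * L) = 1 / real n ^ 19"
      using n exp_of_nat_mult[of 19 L] by (simp add: exp_minus L_def inverse_eq_divide)
    ultimately show ?thesis by (simp add: mult_ac)
  qed
  finally show ?thesis .
qed

section \<open>Union bound and limit\<close>

lemma prob_Union_le:
  assumes "finite A" "\<And>a. a \<in> A \<Longrightarrow> measure_pmf.prob q (B a) \<le> f a"
  shows "measure_pmf.prob q (\<Union>a\<in>A. B a) \<le> (\<Sum>a\<in>A. f a)"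
proof -
  have "measure_pmf.prob q (\<Union>a\<in>A. B a) \<le> (\<Sum>a\<in>A. measure_pmf.prob q (B a))"
    using assms(1) by (intro measure_pmf.finite_measure_subadditive_finite) auto
  also have "\<dots> \<le> (\<Sum>a\<in>A. f a)" using assms(2) by (rule sum_mono)
  finally show ?thesis .
qed

lemma sum_Pow_power_card:
  fixes x :: real
  assumes "finite A"
  shows "(\<Sum>V\<in>Pow A. x ^ card V) = (1 + x) ^ card A"
  using prod_add[OF assms, of "\<lambda>_. x" "\<lambda>_. 1"] by (simp add: add.commute)

text \<open>Union bound over \<open>V\<close>, \<open>I\<close>, \<open>J\<close> and
  \<open>Z\<close>. For fixed \<open>V\<close> there are at most \<open>n ^ card V\<close> pairs of
  \<open>I\<close> and \<open>J\<close>, at most \<open>n ^ (4 * card V)\<close> patterns for each,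
  and each pattern has probability at most \<open>n\<close> to the power
  \<open>- 19 * card V\<close>.\<close>

lemma (in field) prob_minrank_small_le:
  fixes p :: real
  assumes n: "n \<ge> 4" and p: "1 / real n \<le> p" "p \<le> 1"
  shows "measure_pmf.prob (gnp n p)
      {f. \<not> real (minrank R n (adj_of f)) \<ge> real n * ln (1 / p) / (80 * ln (real n))}
      \<le> (1 + 1 / real n ^ 14) ^ (n\<^sup>2) - 1"
proof -
  let ?X = "{..<n} \<times> {..<n}"
  let ?L = "ln (real n)" and ?l = "ln (1 / p)"
  \<comment> \<open>The exponent is 19 - 4 - 1: edge probability against patterns and choices of
    bases.\<close>
  define b where "b = 1 / real n ^ 14"
  define ev where "ev Z = {f. \<forall>(i, j)\<in>Z. i \<noteq> j \<longrightarrow> adj_of f i j}" for Z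
  \<comment> \<open>The index set \<open>T\<close> is recovered as the set of second coordinates of
    \<open>V\<close>, so the union ranges over \<open>V\<close>, \<open>I\<close>, \<open>J\<close>
    and \<open>Z\<close> alone. The two inequalities are what \<open>edge_probability_le\<close>
    requires.\<close>
  define \<Z> where "\<Z> V I J = {Z\<in>basis_patterns (snd ` V) I J V.
      card (snd ` V) * card V \<le> 2 * card I * card Z \<and>
      80 * real (card I) * ?L \<le> real (card (snd ` V)) * ?l}" for V :: "(nat \<times> nat) set" and I J
  have p0: "0 \<le> p" using p n by (meson divide_nonneg_nonneg of_nat_0_le_iff order_trans zero_le_one)
  have L: "?L > 0" using n by simp
  have cover: "{f. \<not> real (minrank R n (adj_of f)) \<ge> real n * ?l / (80 * ?L)}
      \<subseteq> (\<Union>V\<in>Pow ?X - {{}}. \<Union>I\<in>Pow (snd ` V). \<Union>J\<in>Pow (snd ` V). \<Union>Z\<in>\<Z> V I J. ev Z)"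
  proof
    fix f assume "f \<in> {f. \<not> real (minrank R n (adj_of f)) \<ge> real n * ?l / (80 * ?L)}"
    then have small: "80 * ?L * real (minrank R n (adj_of f)) \<le> real n * ?l"
      using L by (simp add: field_simps)
    have "n > 0" using n by simp
    then obtain T I J V Z where *: "T \<subseteq> {..<n}" "I \<subseteq> T" "J \<subseteq> T" "V \<subseteq> T \<times> T" "V \<noteq> {}"
      "snd ` V = T" "Z \<in> basis_patterns T I J V" "\<forall>(i, j)\<in>Z. i \<noteq> j \<longrightarrow> adj_of f i j"
      "card T * card V \<le> 2 * card I * card Z" "card I * n \<le> minrank R n (adj_of f) * card T"
      by (rule minrank_sparse_pattern)
    have "real (card I * n) \<le> real (minrank R n (adj_of f) * card T)"
      using *(10) by (simp only: of_nat_le_iff)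
    then have "80 * ?L * (real (card I) * real n) \<le> 80 * ?L * (real (minrank R n (adj_of f)) * real (card T))"
      using L by (intro mult_left_mono) auto
    also have "\<dots> = (80 * ?L * real (minrank R n (adj_of f))) * real (card T)" by simp
    also have "\<dots> \<le> (real n * ?l) * real (card T)" using small by (intro mult_right_mono) auto
    finally have "real n * (80 * real (card I) * ?L) \<le> real n * (real (card T) * ?l)"
      by (simp only: mult_ac)
    then have "80 * real (card I) * ?L \<le> real (card T) * ?l" using n by simp
    then have "Z \<in> \<Z> V I J" using * by (simp add: \<Z>_def)
    moreover have "V \<in> Pow ?X - {{}}" using *(1,4,5) by blast
    moreover have "I \<in> Pow (snd ` V)" "J \<in> Pow (snd ` V)" using *(2,3,6) by auto
    moreover have "f \<in> ev Z" using *(8) by (simp add: ev_def)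
    ultimately show "f \<in> (\<Union>V\<in>Pow ?X - {{}}. \<Union>I\<in>Pow (snd ` V). \<Union>J\<in>Pow (snd ` V). \<Union>Z\<in>\<Z> V I J. ev Z)"
      by blast
  qed
  have perV: "measure_pmf.prob (gnp n p) (\<Union>I\<in>Pow (snd ` V). \<Union>J\<in>Pow (snd ` V). \<Union>Z\<in>\<Z> V I J. ev Z)
      \<le> b ^ card V" if V: "V \<in> Pow ?X - {{}}" for V
  proof -
    let ?T = "snd ` V" and ?q = "(1 / real n ^ 19) ^ card V"
    have finV: "finite V" using V by (auto intro: finite_subset)
    have finT: "finite ?T" using finV by simp
    have T: "?T \<subseteq> {..<n}" "?T \<noteq> {}" using V by auto
    have T0: "card ?T > 0" using T finT by (simp add: card_gt_0_iff)
    have tv: "card ?T \<le> card V" using finV by (rule card_image_le)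
    have tn: "card ?T \<le> n" using card_mono[OF _ T(1)] by simp
    have single: "measure_pmf.prob (gnp n p) (ev Z) \<le> ?q" if Z: "Z \<in> \<Z> V I J" for Z I J
    proof -
      have "Z \<subseteq> ?T \<times> ?T" using Z basis_patterns_subset unfolding \<Z>_def by blast
      then obtain e where e: "card Z \<le> 2 * e + card ?T" "measure_pmf.prob (gnp n p) (ev Z) = p ^ e"
        unfolding ev_def by (rule prob_pattern_le[OF T(1) _ p0 p(2)])
      have "p ^ e \<le> ?q"
        using Z e(1) n by (intro edge_probability_le[OF _ p(1) tv T0, of "card _" "card Z"]) (auto simp: \<Z>_def)
      with e(2) show ?thesis by simp
    qed
    have finB: "finite (basis_patterns ?T I J V)" for I J
      by (rule finite_subset[OF basis_patterns_subset]) (simp add: finT)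
    have finZ: "finite (\<Z> V I J)" for I J
      using finB unfolding \<Z>_def by simp
    have cardZ: "real (card (\<Z> V I J)) \<le> (real n ^ 4) ^ card V" if I: "I \<in> Pow ?T" for I J
    proof -
      have "card I \<le> n" using card_mono[OF finT, of I] I tn by auto
      have "card (\<Z> V I J) \<le> card (basis_patterns ?T I J V)"
        using finB unfolding \<Z>_def by (intro card_mono) auto
      also have "\<dots> \<le> (card (?T \<times> ?T) * (card I + 1) + 1) ^ card V"
        by (rule card_basis_patterns[OF finT finV])
      also have "\<dots> \<le> (n ^ 4) ^ card V"
      proof (rule power_mono)
        have "card (?T \<times> ?T) * (card I + 1) + 1 \<le> n * n * (n + 1) + 1"
          using tn \<open>card I \<le> n\<close> by (auto simp: card_cartesian_product intro!: add_mono mult_mono)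
        also have "\<dots> \<le> n * n * (n + 1) + n * n" using n by simp
        also have "\<dots> = n * n * (n + 2)" by (simp add: algebra_simps)
        also have "\<dots> \<le> n * n * (n * n)"
        proof (intro mult_left_mono)
          have "n + 2 \<le> 2 * n" using n by simp
          also have "\<dots> \<le> n * n" using n by simp
          finally show "n + 2 \<le> n * n" .
        qed simp
        finally show "card (?T \<times> ?T) * (card I + 1) + 1 \<le> n ^ 4" by (simp add: power4_eq_xxxx mult_ac)
      qed simp
      finally show ?thesis by (metis of_nat_le_iff of_nat_power)
    qed
    have q0: "?q \<ge> 0" by simp
    have IJ: "measure_pmf.prob (gnp n p) (\<Union>Z\<in>\<Z> V I J. ev Z) \<le> (real n ^ 4) ^ card V * ?q"
      if I: "I \<in> Pow ?T" for I J
    proof -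
      have "measure_pmf.prob (gnp n p) (\<Union>Z\<in>\<Z> V I J. ev Z) \<le> (\<Sum>Z\<in>\<Z> V I J. ?q)"
        by (rule prob_Union_le[OF finZ single])
      also have "\<dots> = real (card (\<Z> V I J)) * ?q" by simp
      also have "\<dots> \<le> (real n ^ 4) ^ card V * ?q" using cardZ[OF I] q0 by (rule mult_right_mono)
      finally show ?thesis .
    qed
    have "measure_pmf.prob (gnp n p) (\<Union>I\<in>Pow ?T. \<Union>J\<in>Pow ?T. \<Union>Z\<in>\<Z> V I J. ev Z)
        \<le> (\<Sum>I\<in>Pow ?T. \<Sum>J\<in>Pow ?T. (real n ^ 4) ^ card V * ?q)"
      using finT IJ by (intro prob_Union_le) auto
    also have "\<dots> = (2 ^ card ?T * 2 ^ card ?T) * ((real n ^ 4) ^ card V * ?q)"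
      using finT by (simp add: card_Pow)
    also have "\<dots> = 4 ^ card ?T * ((real n ^ 4) ^ card V * ?q)"
      by (simp add: power_mult_distrib[symmetric])
    also have "\<dots> \<le> real n ^ card V * ((real n ^ 4) ^ card V * ?q)"
    proof (intro mult_right_mono)
      \<comment> \<open>Here \<open>n \<ge> 4\<close> and \<open>card T \<le> card V\<close> absorb
        the choices of \<open>I\<close> and \<open>J\<close> into one factor \<open>n\<close> per
        element of \<open>V\<close>.\<close>
      have "(4::real) ^ card ?T \<le> 4 ^ card V" using tv by (intro power_increasing) auto
      also have "\<dots> \<le> real n ^ card V" using n by (intro power_mono) auto
      finally show "(4::real) ^ card ?T \<le> real n ^ card V" .
    qed simp
    also have "\<dots> = (real n * (real n ^ 4 * (1 / real n ^ 19))) ^ card V"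
      by (simp only: power_mult_distrib)
    also have "real n * (real n ^ 4 * (1 / real n ^ 19)) = b"
    proof -
      have "real n ^ 19 = real n * real n ^ 4 * real n ^ 14" by (simp flip: power_Suc power_add)
      then show ?thesis using n by (simp add: b_def)
    qed
    finally show ?thesis .
  qed
  have "measure_pmf.prob (gnp n p) {f. \<not> real (minrank R n (adj_of f)) \<ge> real n * ?l / (80 * ?L)}
      \<le> measure_pmf.prob (gnp n p)
        (\<Union>V\<in>Pow ?X - {{}}. \<Union>I\<in>Pow (snd ` V). \<Union>J\<in>Pow (snd ` V). \<Union>Z\<in>\<Z> V I J. ev Z)"
    using cover by (intro measure_pmf.finite_measure_mono) auto
  also have "\<dots> \<le> (\<Sum>V\<in>Pow ?X - {{}}. b ^ card V)"
    by (rule prob_Union_le[OF _ perV]) auto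
  \<comment> \<open>The excluded empty set accounts for the subtracted 1; without this the bound
    would not tend to zero.\<close>
  also have "\<dots> = (\<Sum>V\<in>Pow ?X. b ^ card V) - 1"
    by (simp add: sum_diff1)
  also have "\<dots> = (1 + b) ^ (n\<^sup>2) - 1"
    by (simp add: sum_Pow_power_card power2_eq_square card_cartesian_product)
  finally show ?thesis by (simp add: b_def)
qed

theorem theorem1p1:
  fixes F :: "nat \<Rightarrow> 'a ring" and p :: "nat \<Rightarrow> real"
  assumes fields: "\<And>n. field (F n)"
    and p_lower: "\<And>n. n \<ge> 1 \<Longrightarrow> 1 / real n \<le> p n"
    and p_upper: "\<And>n. p n \<le> 1"
  shows "(\<lambda>n. measure_pmf.prob (gnp n (p n))
            {f. real (minrank (F n) n (adj_of f)) \<ge> real n * ln (1 / p n) / (80 * ln (real n))})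
         \<longlonglongrightarrow> 1"
proof -
  let ?good = "\<lambda>n. {f. real (minrank (F n) n (adj_of f)) \<ge> real n * ln (1 / p n) / (80 * ln (real n))}"
  \<comment> \<open>By \<open>1 + x \<le> exp x\<close> the failure probability is at most
    \<open>exp (n\<^sup>2 / n ^ 14) - 1\<close>, which tends to zero.\<close>
  have lower: "2 - exp (1 / real n ^ 12) \<le> measure_pmf.prob (gnp n (p n)) (?good n)" if n: "n \<ge> 4" for n
  proof -
    have "measure_pmf.prob (gnp n (p n)) (?good n) = 1 - measure_pmf.prob (gnp n (p n)) (- ?good n)"
      by (subst measure_pmf.prob_compl[symmetric, of "- ?good n", simplified]) (auto simp: Compl_eq_Diff_UNIV[symmetric])
    moreover have "- ?good n = {f. \<not> real (minrank (F n) n (adj_of f)) \<ge> real n * ln (1 / p n) / (80 * ln (real n))}"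
      by blast
    moreover have "measure_pmf.prob (gnp n (p n)) \<dots> \<le> (1 + 1 / real n ^ 14) ^ (n\<^sup>2) - 1"
      using field.prob_minrank_small_le[OF fields n] p_lower p_upper n by simp
    moreover have "(1 + 1 / real n ^ 14) ^ (n\<^sup>2) \<le> exp (1 / real n ^ 12)"
    proof -
      have "(1 + 1 / real n ^ 14) ^ (n\<^sup>2) \<le> exp (1 / real n ^ 14) ^ (n\<^sup>2)"
        by (intro power_mono exp_ge_add_one_self) simp
      also have "\<dots> = exp (real (n\<^sup>2) * (1 / real n ^ 14))" by (rule exp_of_nat_mult[symmetric])
      also have "real (n\<^sup>2) * (1 / real n ^ 14) = 1 / real n ^ 12"
        using n by (simp add: field_simps flip: power_add)
      finally show ?thesis .
    qed
    ultimately show ?thesis by simp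
  qed
  have "(\<lambda>n. 2 - exp (1 / real n ^ 12)) \<longlonglongrightarrow> 2 - exp 0"
    by (intro tendsto_intros) real_asymp
  then have "(\<lambda>n. 2 - exp (1 / real n ^ 12)) \<longlonglongrightarrow> 1" by simp
  then show ?thesis
  proof (rule tendsto_sandwich[rotated 2])
    show "\<forall>\<^sub>F n in sequentially. 2 - exp (1 / real n ^ 12) \<le> measure_pmf.prob (gnp n (p n)) (?good n)"
      using eventually_ge_at_top[of 4] by eventually_elim (rule lower)
    show "\<forall>\<^sub>F n in sequentially. measure_pmf.prob (gnp n (p n)) (?good n) \<le> 1" by simp
  qed simp
qed

end
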